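(* Let $D$ be a non-commutative division ring and $n\geq 2$ a natural number. Let $k$ be a positive integer such that each element of $D'$ can be written as a product of at most $k$ commutators. Then each $A\in \mathrm{SL}_n(D)$ is a product of at most $3k+2$ unipotent elements of $\mathrm{M}_n(D)$.
   Context: $D'$ denotes the derived subgroup of $D^*=D\setminus\{0\}$, generated by all commutators $[x,y]=xyx^{-1}y^{-1}$, $x,y\in D^*$; "commutators" in the hypothesis are such elements $[x,y]$ with $x,y\in D^*$. For $n\ge 2$, $\mathrm{SL}_n(D)$ is the kernel of the Dieudonné determinant on $\mathrm{GL}_n(D)$. A matrix $x\in \mathrm{M}_n(D)$ is unipotent if $\mathrm{I}_n-x$ is nilpotent. *)

theory Defs
  imports
    "Jordan_Normal_Form.Matrix"
    "HOL-Algebra.Generated_Groups"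
    "HOL-Combinatorics.Permutations"
begin

definition mult_grp :: "'a::division_ring monoid" where
  "mult_grp = \<lparr>carrier = UNIV - {0}, mult = (*), one = 1\<rparr>"

abbreviation derived_units :: "'a::division_ring set" where
  "derived_units \<equiv> derived mult_grp (carrier mult_grp)"

definition commutator_elems :: "'a::division_ring set" where
  "commutator_elems = {x * y * inverse x * inverse y | x y. x \<noteq> 0 \<and> y \<noteq> 0}"

abbreviation GL :: "nat \<Rightarrow> 'a::division_ring mat monoid" where
  "GL n \<equiv> units_of (ring_mat TYPE('a) n ())"

definition upper_unitriangular :: "nat \<Rightarrow> 'a::division_ring mat \<Rightarrow> bool" where
  "upper_unitriangular n A \<longleftrightarrow>
     A \<in> carrier_mat n n \<and> upper_triangular A \<and> (\<forall>i<n. A $$ (i, i) = 1)"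

definition monomial_mat :: "nat \<Rightarrow> (nat \<Rightarrow> nat) \<Rightarrow> (nat \<Rightarrow> 'a) \<Rightarrow> 'a::division_ring mat" where
  "monomial_mat n p u = mat n n (\<lambda>(i, j). if j = p i then u i else 0)"

text \<open>
  The Dieudonne determinant, with values in the abelianization of the multiplicative group.
  Every invertible \<open>A\<close> has a Bruhat decomposition \<open>A = U M V\<close> with \<open>U\<close>, \<open>V\<close> upper unitriangular
  and \<open>M\<close> monomial; \<open>U\<close> and \<open>V\<close> need not be unique, but \<open>M\<close> is, and the determinant is the class
  of the sign of the permutation of \<open>M\<close> times the product of its nonzero entries. The order of
  the factors does not matter modulo commutators. The value is meaningful only on
  \<open>carrier (GL n)\<close>.
\<close>

definition dieudonne_det :: "nat \<Rightarrow> 'a::division_ring mat \<Rightarrow> 'a set" where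
  "dieudonne_det n A = (THE c. \<exists>U V p u.
     upper_unitriangular n U \<and> upper_unitriangular n V \<and>
     p permutes {..<n} \<and> (\<forall>i<n. u i \<noteq> 0) \<and>
     A = U * monomial_mat n p u * V \<and>
     c = derived_units #>\<^bsub>mult_grp\<^esub> (of_int (sign p) * prod_list (map u [0..<n])))"

definition SL :: "nat \<Rightarrow> 'a::division_ring mat set" where
  "SL n = kernel (GL n) (mult_grp Mod derived_units) (dieudonne_det n)"

definition unipotent_mat :: "nat \<Rightarrow> 'a::division_ring mat \<Rightarrow> bool" where
  "unipotent_mat n A \<longleftrightarrow>
     A \<in> carrier_mat n n \<and> (\<exists>m. (1\<^sub>m n - A) ^\<^sub>m m = 0\<^sub>m n n)"

end

theory Submission
  imports Defs "Jordan_Normal_Form.Gauss_Jordan_Elimination"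
begin

text \<open>
  Suppose first that \<open>A\<close> is not a scalar matrix with central entry. Elimination, with pivots
  arranged to be \<open>1\<close>, then shows that \<open>A\<close> is similar to \<open>X * diag (1, \<dots>, 1, d) * Y\<close> with \<open>X\<close> and
  \<open>Y\<close> unipotent (\<open>noncentral_LDU\<close>). Similarity preserves the Dieudonne determinant and \<open>X\<close>, \<open>Y\<close> have
  trivial determinant, so \<open>d\<close> lies in the derived subgroup and is a product of at most \<open>k\<close>
  commutators. Each \<open>diag (1, \<dots>, 1, [x, y])\<close> is a product of three unipotents
  (\<open>unipotent_product_diag_commutator\<close>), which gives \<open>3 * k + 2\<close> factors in all. The bound of three
  comes from \<open>2 \<times> 2\<close> matrices: the companion matrix with last column \<open>(- d, t)\<close> is similar to the one
  with last column \<open>(- 1, t')\<close>, a product of two unipotents, as soon as \<open>d\<close> is a commutator and \<open>t\<close> is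
  chosen suitably; one further transvection adjusts \<open>t\<close>.

  If \<open>A\<close> is the scalar matrix of a central element \<open>a\<close>, then \<open>a ^ n\<close> lies in the derived subgroup,
  and \<open>A\<close> is the product of \<open>diag (a, \<dots>, a, a * a ^ (- n))\<close> and \<open>diag (1, \<dots>, 1, a ^ n)\<close>. The first
  matrix lives over the centre of \<open>D\<close>, a field, where it has determinant \<open>1\<close>. Unless it is scalar,
  the noncentral case over that field writes it as a product of two unipotents, because there \<open>d\<close> has
  to be \<open>1\<close>. If it is scalar, then \<open>a ^ n = 1\<close>, and \<open>A\<close> times a transvection
  takes its place, so that \<open>A\<close> is a product of three unipotents.

  The determinant of the hypothesis is read off a Bruhat decomposition, so its behaviour under
  products has to be established. The monomial factor of a Bruhat decomposition is unique
  (\<open>monomial_mat_unique\<close>), and left multiplication by a unitriangular matrix, an invertible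
  diagonal matrix or an adjacent transposition changes its class in the expected way
  (\<open>bruhat_unitriangular_mult\<close>, \<open>bruhat_diag_mult\<close>, \<open>bruhat_adjacent_swap\<close>). Hence a product
  of such generators has a well-defined determinant, namely the product of the determinants of
  the factors. All similarities used for \<open>noncentral_LDU\<close> are by such products, which also
  yields a Bruhat decomposition of \<open>A\<close> itself.
\<close>

section \<open>The abelianized multiplicative group\<close>

definition abel_class :: "'a::division_ring \<Rightarrow> 'a set" where
  "abel_class c = derived_units #>\<^bsub>mult_grp\<^esub> c"

lemma mult_grp_simps [simp]:
  "carrier mult_grp = UNIV - {0}"
  "x \<otimes>\<^bsub>mult_grp\<^esub> y = x * y"
  "\<one>\<^bsub>mult_grp\<^esub> = 1"
  by (simp_all add: mult_grp_def)

lemma group_mult_grp: "group (mult_grp :: 'a::division_ring monoid)"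
proof (rule groupI)
  fix x :: 'a assume "x \<in> carrier mult_grp"
  then show "\<exists>y\<in>carrier mult_grp. y \<otimes>\<^bsub>mult_grp\<^esub> x = \<one>\<^bsub>mult_grp\<^esub>"
    by (intro bexI [of _ "inverse x"]) auto
qed (auto simp: mult.assoc)

interpretation D: group "mult_grp :: 'a::division_ring monoid"
  by (rule group_mult_grp)

interpretation DD: normal "derived_units :: 'a set" "mult_grp :: 'a::division_ring monoid"
  by (rule D.derived_self_is_normal)

lemma mult_abel_class: "a \<noteq> 0 \<Longrightarrow> b \<noteq> 0 \<Longrightarrow> abel_class a <#>\<^bsub>mult_grp\<^esub> abel_class b = abel_class (a * b)"
  unfolding abel_class_def using DD.rcos_sum [of a b] by simp

lemma abel_class_cong:
  assumes "abel_class a = abel_class a'" "abel_class b = abel_class b'" "a \<noteq> 0" "b \<noteq> 0" "a' \<noteq> 0" "b' \<noteq> 0"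
  shows "abel_class (a * b) = abel_class (a' * b')"
  using assms by (metis mult_abel_class)

lemma abel_class_commute:
  fixes a b :: "'a::division_ring"
  assumes "a \<noteq> 0" "b \<noteq> 0"
  shows "abel_class (a * b) = abel_class (b * a)"
proof -
  interpret Q: comm_group "(mult_grp :: 'a monoid) Mod derived_units"
    by (rule D.derived_quot_is_comm_group)
  have "abel_class x \<in> carrier (mult_grp Mod derived_units)" if "x \<noteq> 0" for x :: 'a
    using that by (auto simp: FactGroup_def RCOSETS_def abel_class_def)
  with Q.m_comm [of "abel_class a" "abel_class b"] assms show ?thesis
    by (simp add: FactGroup_def mult_abel_class)
qed

lemma abel_class_one: "abel_class (1 :: 'a::division_ring) = derived_units"
  unfolding abel_class_def using D.coset_mult_one [OF DD.subset] by simp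

lemma abel_class_eq_one_iff:
  fixes c :: "'a::division_ring"
  assumes "c \<noteq> 0" shows "abel_class c = abel_class 1 \<longleftrightarrow> c \<in> derived_units"
  unfolding abel_class_one using assms D.coset_join1 [OF _ _ DD.subgroup_axioms, of c]
    D.coset_join2 [OF _ DD.subgroup_axioms, of c] DD.subset
  unfolding abel_class_def by auto

lemma abel_class_swap:
  assumes "a \<noteq> 0" "b \<noteq> 0" "c \<noteq> 0"
  shows "abel_class (a * (b * c)) = abel_class (b * (a * c))"
  using abel_class_cong [OF abel_class_commute [of a b] refl, of c] assms by (simp add: mult.assoc)

text \<open>
  Modulo commutators the order of the factors is irrelevant; in this form every rearrangement of
  determinant factors becomes an equality of multisets.
\<close>

lemma abel_class_prod_list_mset:
  fixes xs ys :: "'a::division_ring list"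
  assumes "mset xs = mset ys" "0 \<notin> set xs"
  shows "abel_class (prod_list xs) = abel_class (prod_list ys)"
  using assms
proof (induction xs arbitrary: ys)
  case (Cons a xs)
  then have "a \<in> set ys" by (metis list.set_intros(1) set_mset_mset)
  then obtain l r where ys: "ys = l @ a # r" by (meson split_list)
  with Cons.prems have ms: "mset xs = mset (l @ r)" by simp
  then have "set xs = set (l @ r)" by (metis set_mset_mset)
  with Cons.prems have nz: "0 \<notin> set l" "0 \<notin> set r" "0 \<notin> set xs" "a \<noteq> 0" by auto
  have "abel_class (a * prod_list xs) = abel_class (a * prod_list (l @ r))"
    using Cons.IH [OF ms] nz by (intro abel_class_cong) (auto simp: prod_list_zero_iff)
  also have "\<dots> = abel_class (prod_list l * (a * prod_list r))"
    using nz abel_class_swap [of a "prod_list l" "prod_list r"] by (simp add: prod_list_zero_iff)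
  finally show ?case by (simp add: ys)
qed simp

lemma abel_class_prod_list_permutes:
  fixes u :: "nat \<Rightarrow> 'a::division_ring"
  assumes "q permutes {..<n}" "\<And>i. i < n \<Longrightarrow> u i \<noteq> 0"
  shows "abel_class (prod_list (map (\<lambda>i. u (q i)) [0..<n])) = abel_class (prod_list (map u [0..<n]))"
proof (rule abel_class_prod_list_mset)
  have "mset (map (\<lambda>i. u (q i)) [0..<n]) = image_mset u (image_mset q (mset_set {..<n}))"
    by (simp add: image_mset.compositionality comp_def lessThan_atLeast0)
  also have "image_mset q (mset_set {..<n}) = mset_set {..<n}"
    using assms(1) by (simp add: permutes_image_mset)
  finally show "mset (map (\<lambda>i. u (q i)) [0..<n]) = mset (map u [0..<n])"
    by (simp add: lessThan_atLeast0)
  show "0 \<notin> set (map (\<lambda>i. u (q i)) [0..<n])"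
    using assms permutes_in_image [OF assms(1)] by force
qed

lemma abel_class_prod_list_mult:
  fixes d u :: "nat \<Rightarrow> 'a::division_ring"
  assumes "\<And>i. i \<in> set xs \<Longrightarrow> d i \<noteq> 0 \<and> u i \<noteq> 0"
  shows "abel_class (prod_list (map (\<lambda>i. d i * u i) xs)) = abel_class (prod_list (map d xs) * prod_list (map u xs))"
proof -
  have "mset (map d xs @ map u xs) = mset (concat (map (\<lambda>i. [d i, u i]) xs))"
    by (induction xs) auto
  then have "abel_class (prod_list (map d xs @ map u xs)) = abel_class (prod_list (concat (map (\<lambda>i. [d i, u i]) xs)))"
    by (rule abel_class_prod_list_mset) (use assms in force)
  also have "prod_list (concat (map (\<lambda>i. [d i, u i]) xs)) = prod_list (map (\<lambda>i. d i * u i) xs)"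
    by (induction xs) (auto simp: mult.assoc)
  finally show ?thesis by simp
qed

section \<open>Elementary, monomial and unitriangular matrices\<close>

lemma mult_addrow_mat:
  fixes A :: "'a::semiring_1 mat"
  assumes A: "A \<in> carrier_mat m n" and kl: "k < n" "l < n" "k \<noteq> l"
  shows "A * addrow_mat n x k l =
    mat m n (\<lambda>(i,j). if j = l then A $$ (i,l) + A $$ (i,k) * x else A $$ (i,j))"
proof (rule eq_matI)
  fix i j assume "i < dim_row (mat m n (\<lambda>(i,j). if j = l then A $$ (i,l) + A $$ (i,k) * x else A $$ (i,j)))"
    and "j < dim_col (mat m n (\<lambda>(i,j). if j = l then A $$ (i,l) + A $$ (i,k) * x else A $$ (i,j)))"
  then have ij: "i < m" "j < n" by auto
  have "(A * addrow_mat n x k l) $$ (i,j) = (\<Sum>t\<in>{0..<n}. A $$ (i,t) * addrow_mat n x k l $$ (t,j))"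
    using A ij by (simp add: scalar_prod_def)
  also have "\<dots> = (\<Sum>t\<in>{0..<n}. (if t = j then A $$ (i,t) else 0) + (if t = k then (if j = l then A $$ (i,k) * x else 0) else 0))"
    using ij kl by (intro sum.cong) (auto simp: distrib_left)
  also have "\<dots> = A $$ (i,j) + (if j = l then A $$ (i,k) * x else 0)"
    using ij kl by (simp add: sum.distrib)
  finally show "(A * addrow_mat n x k l) $$ (i,j) =
    mat m n (\<lambda>(i,j). if j = l then A $$ (i,l) + A $$ (i,k) * x else A $$ (i,j)) $$ (i,j)"
    using ij by auto
qed (use A in auto)

lemma mult_swaprows_mat:
  fixes A :: "'a::semiring_1 mat"
  assumes A: "A \<in> carrier_mat m n" and kl: "k < n" "l < n"
  shows "A * swaprows_mat n k l = mat m n (\<lambda>(i,j). A $$ (i, transpose k l j))"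
proof (rule eq_matI)
  fix i j assume "i < dim_row (mat m n (\<lambda>(i,j). A $$ (i, transpose k l j)))"
    and "j < dim_col (mat m n (\<lambda>(i,j). A $$ (i, transpose k l j)))"
  then have ij: "i < m" "j < n" by auto
  have "(A * swaprows_mat n k l) $$ (i,j) = (\<Sum>t\<in>{0..<n}. A $$ (i,t) * swaprows_mat n k l $$ (t,j))"
    using A ij by (simp add: scalar_prod_def)
  also have "\<dots> = (\<Sum>t\<in>{0..<n}. (if t = transpose k l j then A $$ (i,t) else 0))"
    using ij kl by (intro sum.cong) (auto simp: transpose_def)
  also have "\<dots> = A $$ (i, transpose k l j)"
    using ij kl by (auto simp: transpose_def)
  finally show "(A * swaprows_mat n k l) $$ (i,j) = mat m n (\<lambda>(i,j). A $$ (i, transpose k l j)) $$ (i,j)"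
    using ij by simp
qed (use A in auto)

lemma swaprows_mat_mult:
  fixes A :: "'a::semiring_1 mat"
  assumes A: "A \<in> carrier_mat n m" and kl: "k < n" "l < n"
  shows "swaprows_mat n k l * A = mat n m (\<lambda>(i,j). A $$ (transpose k l i, j))"
  using A kl by (subst swaprows_mat [symmetric]) (auto simp: transpose_def)

lemma swaprows_mat_conj:
  fixes A :: "'a::semiring_1 mat"
  assumes A: "A \<in> carrier_mat n n" and kl: "k < n" "l < n"
  shows "swaprows_mat n k l * A * swaprows_mat n k l =
    mat n n (\<lambda>(i,j). A $$ (transpose k l i, transpose k l j))"
proof -
  have t: "transpose k l i < n" if "i < n" for i
    using that kl by (auto simp: transpose_def)
  show ?thesis
    unfolding swaprows_mat_mult [OF A kl]
    by (subst mult_swaprows_mat [OF _ kl]) (auto simp: t intro!: eq_matI)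
qed

lemma addrow_mat_inverse:
  fixes x :: "'a::ring_1"
  assumes "k < n" "l < n" "k \<noteq> l"
  shows "addrow_mat n x k l * addrow_mat n (-x) k l = 1\<^sub>m n"
    and "addrow_mat n (-x) k l * addrow_mat n x k l = 1\<^sub>m n"
  using assms by (subst mult_addrow_mat [where m = n]; force intro!: eq_matI)+

lemma monomial_mat_carrier [simp]: "monomial_mat n p u \<in> carrier_mat n n"
  by (simp add: monomial_mat_def)

lemma dim_monomial_mat [simp]: "dim_row (monomial_mat n p u) = n" "dim_col (monomial_mat n p u) = n"
  by (simp_all add: monomial_mat_def)

text \<open>
  A monomial matrix acts from the left by permuting and scaling rows. Its action from the right on
  columns (\<open>mult_monomial_mat_entry\<close> below) is indexed by \<open>p j\<close>, which avoids the inverse permutation.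
\<close>

lemma monomial_mat_mult:
  assumes A: "A \<in> carrier_mat n m" and p: "\<And>i. i < n \<Longrightarrow> p i < n"
  shows "monomial_mat n p u * A = mat n m (\<lambda>(i,j). u i * A $$ (p i, j))"
proof (rule eq_matI)
  fix i j assume "i < dim_row (mat n m (\<lambda>(i,j). u i * A $$ (p i, j)))"
    and "j < dim_col (mat n m (\<lambda>(i,j). u i * A $$ (p i, j)))"
  then have ij: "i < n" "j < m" by auto
  have "(monomial_mat n p u * A) $$ (i,j) = (\<Sum>t\<in>{0..<n}. monomial_mat n p u $$ (i,t) * A $$ (t,j))"
    using A ij by (simp add: scalar_prod_def)
  also have "\<dots> = (\<Sum>t\<in>{0..<n}. if t = p i then u i * A $$ (t,j) else 0)"
    using ij by (intro sum.cong) (auto simp: monomial_mat_def)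
  also have "\<dots> = u i * A $$ (p i, j)" using p [OF ij(1)] by simp
  finally show "(monomial_mat n p u * A) $$ (i,j) = mat n m (\<lambda>(i,j). u i * A $$ (p i, j)) $$ (i,j)"
    using ij by simp
qed (use A in auto)

lemma mult_monomial_mat_entry:
  fixes A :: "'a::division_ring mat"
  assumes A: "A \<in> carrier_mat m n" and ij: "i < m" "j < n" and p: "p permutes {..<n}"
  shows "(A * monomial_mat n p u) $$ (i, p j) = A $$ (i,j) * u j"
proof -
  have pj: "p j < n" using permutes_in_image [OF p, of j] ij(2) by simp
  have "(A * monomial_mat n p u) $$ (i,p j) = (\<Sum>t\<in>{0..<n}. A $$ (i,t) * monomial_mat n p u $$ (t,p j))"
    using A ij pj by (simp add: scalar_prod_def)
  also have "\<dots> = (\<Sum>t\<in>{0..<n}. if t = j then A $$ (i,t) * u j else 0)"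
    using ij pj by (intro sum.cong) (auto simp: monomial_mat_def inj_eq [OF permutes_inj [OF p]])
  also have "\<dots> = A $$ (i,j) * u j" using ij by simp
  finally show ?thesis .
qed

lemma upper_unitriangular_carrier: "upper_unitriangular n U \<Longrightarrow> U \<in> carrier_mat n n"
  by (simp add: upper_unitriangular_def)

lemma upper_unitriangularI:
  assumes "U \<in> carrier_mat n n" "\<And>i. i < n \<Longrightarrow> U $$ (i,i) = 1"
    "\<And>i j. i < n \<Longrightarrow> j < i \<Longrightarrow> U $$ (i,j) = 0"
  shows "upper_unitriangular n U"
  using assms by (auto simp: upper_unitriangular_def)

lemma upper_unitriangularD:
  assumes "upper_unitriangular n U"
  shows "i < n \<Longrightarrow> U $$ (i,i) = 1" "i < n \<Longrightarrow> j < i \<Longrightarrow> U $$ (i,j) = 0"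
  using assms by (auto simp: upper_unitriangular_def)

lemma upper_unitriangular_one: "upper_unitriangular n (1\<^sub>m n)"
  by (auto simp: upper_unitriangular_def)

lemma upper_unitriangular_addrow_mat:
  "k < l \<Longrightarrow> l < n \<Longrightarrow> upper_unitriangular n (addrow_mat n x k l)"
  by (rule upper_unitriangularI) auto

lemma upper_unitriangular_mult:
  fixes U V :: "'a::division_ring mat"
  assumes U: "upper_unitriangular n U" and V: "upper_unitriangular n V"
  shows "upper_unitriangular n (U * V)"
proof -
  note c = upper_unitriangular_carrier [OF U] upper_unitriangular_carrier [OF V]
  have uv: "(U * V) $$ (i,j) = (\<Sum>t\<in>{0..<n}. U $$ (i,t) * V $$ (t,j))" if "i < n" "j < n" for i j
    using c that by (simp add: scalar_prod_def)
  have z: "U $$ (i,t) * V $$ (t,j) = 0" if "i < n" "t < n" "j \<le> i" "t \<noteq> i \<or> j \<noteq> i" for i j t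
    using that upper_unitriangularD(2) [OF U, of i t] upper_unitriangularD(2) [OF V, of t j]
    by (cases "t < i") auto
  show ?thesis
  proof (rule upper_unitriangularI)
    fix i assume i: "i < n"
    have "(\<Sum>t\<in>{0..<n}. U $$ (i,t) * V $$ (t,i)) = (\<Sum>t\<in>{0..<n}. if t = i then 1 else 0)"
      using i z upper_unitriangularD(1) [OF U] upper_unitriangularD(1) [OF V] by (intro sum.cong) auto
    with i show "(U * V) $$ (i,i) = 1" by (simp add: uv)
  next
    fix i j assume "i < n" "j < i"
    then show "(U * V) $$ (i,j) = 0" by (simp add: uv z)
  qed (use c in auto)
qed

lemma upper_unitriangular_four_block:
  fixes U :: "'a::division_ring mat"
  assumes R: "R \<in> carrier_mat 1 m" and U: "upper_unitriangular m U"
  shows "upper_unitriangular (Suc m) (four_block_mat (1\<^sub>m 1) R (0\<^sub>m m 1) U)"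
proof -
  note c = upper_unitriangular_carrier [OF U]
  show ?thesis
    by (rule upper_unitriangularI) (use R c upper_unitriangularD [OF U] in auto)
qed

lemma split_first_row_col:
  fixes A :: "'a mat"
  assumes A: "A \<in> carrier_mat (Suc m) (Suc m)"
  obtains a R C B where "A = four_block_mat (mat 1 1 (\<lambda>_. a)) R C B" "a = A $$ (0,0)"
    "R \<in> carrier_mat 1 m" "C \<in> carrier_mat m 1" "B \<in> carrier_mat m m"
    "\<And>i. i < m \<Longrightarrow> C $$ (i,0) = A $$ (Suc i,0)"
proof -
  define R where "R = mat 1 m (\<lambda>(i,j). A $$ (0, Suc j))"
  define C where "C = mat m 1 (\<lambda>(i,j). A $$ (Suc i, 0))"
  define B where "B = mat m m (\<lambda>(i,j). A $$ (Suc i, Suc j))"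
  have "A = four_block_mat (mat 1 1 (\<lambda>_. A $$ (0,0))) R C B"
    by (rule eq_matI) (use A in \<open>auto simp: R_def C_def B_def\<close>)
  then show ?thesis by (rule that) (auto simp: R_def C_def B_def)
qed

lemma upper_unitriangular_split:
  fixes U :: "'a::division_ring mat"
  assumes U: "upper_unitriangular (Suc m) U"
  obtains R U' where "U = four_block_mat (1\<^sub>m 1) R (0\<^sub>m m 1) U'"
    "R \<in> carrier_mat 1 m" "upper_unitriangular m U'"
proof -
  define R where "R = mat 1 m (\<lambda>(i,j). U $$ (0, Suc j))"
  define U' where "U' = mat m m (\<lambda>(i,j). U $$ (Suc i, Suc j))"
  have "U = four_block_mat (1\<^sub>m 1) R (0\<^sub>m m 1) U'"
    by (rule eq_matI) (use U upper_unitriangular_carrier [OF U] upper_unitriangularD [OF U] in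
        \<open>auto simp: R_def U'_def\<close>)
  moreover have "upper_unitriangular m U'"
    using upper_unitriangularD [OF U] by (intro upper_unitriangularI) (auto simp: U'_def)
  ultimately show ?thesis by (intro that) (auto simp: R_def)
qed

text \<open>
  Splitting off the first row, the inverse of \<open>[1, R; 0, U']\<close> is \<open>[1, - R V'; 0, V']\<close> with \<open>V'\<close> the
  inverse of \<open>U'\<close>.
\<close>

lemma upper_unitriangular_right_inverse:
  fixes U :: "'a::division_ring mat"
  assumes "upper_unitriangular n U"
  shows "\<exists>V. upper_unitriangular n V \<and> U * V = 1\<^sub>m n"
  using assms
proof (induction n arbitrary: U)
  case 0
  then show ?case by (intro exI [of _ U]) (auto simp: upper_unitriangular_def)
next
  case (Suc m)
  from Suc.prems obtain R U' where U: "U = four_block_mat (1\<^sub>m 1) R (0\<^sub>m m 1) U'"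
    and R: "R \<in> carrier_mat 1 m" and U': "upper_unitriangular m U'"
    by (rule upper_unitriangular_split)
  from Suc.IH [OF U'] obtain V' where V': "upper_unitriangular m V'" and inv: "U' * V' = 1\<^sub>m m"
    by blast
  note c = upper_unitriangular_carrier [OF U'] upper_unitriangular_carrier [OF V']
  let ?V = "four_block_mat (1\<^sub>m 1) (- (R * V')) (0\<^sub>m m 1) V'"
  have z: "- (R * V') + R * V' = 0\<^sub>m 1 m" "- 0\<^sub>m m m + 1\<^sub>m m = (1\<^sub>m m :: 'a mat)"
    using R c by (auto simp: mat_eq_iff)
  have "U * ?V = four_block_mat (1\<^sub>m 1) (0\<^sub>m 1 m) (0\<^sub>m m 1) (1\<^sub>m m)"
    unfolding U by (subst mult_four_block_mat [of _ 1 1 _ m _ m _ _ 1 _ m]) (use R c inv in \<open>auto simp: z simp del: One_nat_def\<close>)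
  also have "\<dots> = 1\<^sub>m (Suc m)" by (metis four_block_one_mat plus_1_eq_Suc)
  finally show ?case
    using upper_unitriangular_four_block [OF _ V', of "- (R * V')"] R c by auto
qed

lemma upper_unitriangular_inverse:
  fixes U :: "'a::division_ring mat"
  assumes U: "upper_unitriangular n U"
  obtains V where "upper_unitriangular n V" "U * V = 1\<^sub>m n" "V * U = 1\<^sub>m n"
proof -
  from upper_unitriangular_right_inverse [OF U] obtain V where V: "upper_unitriangular n V" "U * V = 1\<^sub>m n" by blast
  from upper_unitriangular_right_inverse [OF V(1)] obtain W where W: "upper_unitriangular n W" "V * W = 1\<^sub>m n" by blast
  note c = upper_unitriangular_carrier [OF U] upper_unitriangular_carrier [OF V(1)] upper_unitriangular_carrier [OF W(1)]
  have "U = U * (V * W)" using W(2) c by simp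
  also have "\<dots> = W" using c V(2) by (simp flip: assoc_mult_mat [of U n n V n W n])
  finally have "U = W" .
  with that V W show ?thesis by simp
qed

section \<open>Uniqueness of the monomial factor in the Bruhat decomposition\<close>

lemmas sq_assoc = assoc_mult_mat [of _ n n _ n _ n] mult_carrier_mat [of _ n n _ n] for n

text \<open>
  A representative \<open>c\<close> of the Dieudonne determinant of \<open>A\<close>; it is determined only up to the derived
  subgroup.
\<close>

definition bruhat :: "nat \<Rightarrow> 'a::division_ring mat \<Rightarrow> 'a \<Rightarrow> bool" where
  "bruhat n A c \<longleftrightarrow> c \<noteq> 0 \<and> (\<exists>U V p u.
     upper_unitriangular n U \<and> upper_unitriangular n V \<and>
     p permutes {..<n} \<and> (\<forall>i<n. u i \<noteq> 0) \<and>
     A = U * monomial_mat n p u * V \<and>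
     abel_class c = abel_class (of_int (sign p) * prod_list (map u [0..<n])))"

lemma permutes_le_imp_eq:
  fixes p q :: "nat \<Rightarrow> nat"
  assumes p: "p permutes {..<n}" and q: "q permutes {..<n}" and le: "\<And>i. i < n \<Longrightarrow> q i \<le> p i"
  shows "q = p"
proof
  fix i
  have "sum q {..<n} = sum p {..<n}"
    using sum.permute [OF p, of id] sum.permute [OF q, of id] by simp
  then have "i < n \<Longrightarrow> q i = p i"
    using sum_mono_inv [of q "{..<n}" p i] le by simp
  then show "q i = p i"
    using p q by (cases "i < n") (auto simp: permutes_def)
qed

text \<open>
  Comparing the entries at \<open>(i, p i)\<close> gives \<open>u i = v i * V (q i, p i)\<close>. As \<open>u i\<close> is nonzero and
  \<open>V\<close> is upper triangular, \<open>q i \<le> p i\<close> for all \<open>i\<close>, and two permutations comparable in this way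
  agree.
\<close>

lemma monomial_mat_unique:
  fixes U V :: "'a::division_ring mat"
  assumes U: "upper_unitriangular n U" and V: "upper_unitriangular n V"
    and p: "p permutes {..<n}" and q: "q permutes {..<n}" and u: "\<And>i. i < n \<Longrightarrow> u i \<noteq> 0"
    and eq: "U * monomial_mat n p u = monomial_mat n q v * V"
  shows "q = p" and "\<And>i. i < n \<Longrightarrow> v i = u i"
proof -
  note c = upper_unitriangular_carrier [OF U] upper_unitriangular_carrier [OF V]
  have pn: "p i < n" "q i < n" if "i < n" for i
    using permutes_in_image [OF p, of i] permutes_in_image [OF q, of i] that by auto
  have uv: "u i = v i * V $$ (q i, p i)" if i: "i < n" for i
  proof -
    have "(monomial_mat n q v * V) $$ (i, p i) = v i * V $$ (q i, p i)"
      using c(2) pn i by (simp add: monomial_mat_mult)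
    moreover have "(U * monomial_mat n p u) $$ (i, p i) = u i"
      using mult_monomial_mat_entry [OF c(1) i i p] upper_unitriangularD(1) [OF U i] by simp
    ultimately show ?thesis using eq by simp
  qed
  have "q i \<le> p i" if i: "i < n" for i
    using uv [OF i] u [OF i] upper_unitriangularD(2) [OF V, of "q i" "p i"] pn [OF i] by force
  then show "q = p" by (rule permutes_le_imp_eq [OF p q])
  then show "v i = u i" if "i < n" for i
    using uv [OF that] upper_unitriangularD(1) [OF V] pn that by simp
qed

lemma bruhat_unique:
  assumes "bruhat n A c" "bruhat n A d"
  shows "abel_class c = abel_class d"
proof -
  from assms(1) obtain U V p u where 1: "upper_unitriangular n U" "upper_unitriangular n V"
    "p permutes {..<n}" "\<forall>i<n. u i \<noteq> 0" "A = U * monomial_mat n p u * V"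
    "abel_class c = abel_class (of_int (sign p) * prod_list (map u [0..<n]))" unfolding bruhat_def by blast
  from assms(2) obtain W X q v where 2: "upper_unitriangular n W" "upper_unitriangular n X"
    "q permutes {..<n}" "\<forall>i<n. v i \<noteq> 0" "A = W * monomial_mat n q v * X"
    "abel_class d = abel_class (of_int (sign q) * prod_list (map v [0..<n]))" unfolding bruhat_def by blast
  from upper_unitriangular_inverse [OF 2(1)] obtain W' where
    W': "upper_unitriangular n W'" "W' * W = 1\<^sub>m n" by blast
  from upper_unitriangular_inverse [OF 1(2)] obtain V' where
    V': "upper_unitriangular n V'" "V * V' = 1\<^sub>m n" by blast
  note c = 1(1,2) 2(1,2) W'(1) V'(1)
  note c = c [THEN upper_unitriangular_carrier]
  let ?M = "monomial_mat n p u" and ?N = "monomial_mat n q v"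
  have cM: "?M \<in> carrier_mat n n" "?N \<in> carrier_mat n n" by simp_all
  have "(W' * U) * ?M = W' * (U * ?M * (V * V'))"
    using c cM by (simp add: V' sq_assoc [where n = n])
  also have "\<dots> = W' * ((U * ?M * V) * V')" using c cM by (simp add: sq_assoc [where n = n])
  also have "U * ?M * V = W * ?N * X" using 1(5) 2(5) by simp
  also have "W' * ((W * ?N * X) * V') = (W' * W) * (?N * (X * V'))" using c cM by (simp add: sq_assoc [where n = n])
  also have "\<dots> = ?N * (X * V')" using c cM by (simp add: W')
  finally have eq: "(W' * U) * ?M = ?N * (X * V')" .
  have "q = p" "\<And>i. i < n \<Longrightarrow> v i = u i"
    using monomial_mat_unique [OF upper_unitriangular_mult [OF W'(1) 1(1)]
        upper_unitriangular_mult [OF 2(2) V'(1)] 1(3) 2(3) _ eq] 1(4) by auto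
  moreover from this have "map v [0..<n] = map u [0..<n]" by simp
  ultimately show ?thesis using 1(6) 2(6) by (simp only:)
qed

lemma dieudonne_det_bruhat:
  assumes "bruhat n A c"
  shows "dieudonne_det n A = abel_class c"
  unfolding dieudonne_det_def
proof (rule the_equality)
  show "\<exists>U V p u. upper_unitriangular n U \<and> upper_unitriangular n V \<and>
     p permutes {..<n} \<and> (\<forall>i<n. u i \<noteq> 0) \<and> A = U * monomial_mat n p u * V \<and>
     abel_class c = derived_units #>\<^bsub>mult_grp\<^esub> (of_int (sign p) * prod_list (map u [0..<n]))"
    using assms unfolding bruhat_def abel_class_def by blast
next
  fix C assume "\<exists>U V p u. upper_unitriangular n U \<and> upper_unitriangular n V \<and>
     p permutes {..<n} \<and> (\<forall>i<n. u i \<noteq> 0) \<and> A = U * monomial_mat n p u * V \<and>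
     C = derived_units #>\<^bsub>mult_grp\<^esub> (of_int (sign p) * prod_list (map u [0..<n]))"
  then obtain U V p u where 1: "upper_unitriangular n U" "upper_unitriangular n V"
    "p permutes {..<n}" "\<forall>i<n. u i \<noteq> 0" "A = U * monomial_mat n p u * V"
    "C = abel_class (of_int (sign p) * prod_list (map u [0..<n]))"
    unfolding abel_class_def by blast
  have "of_int (sign p) * prod_list (map u [0..<n]) \<noteq> 0"
    using 1(4) by (auto simp: sign_def prod_list_zero_iff)
  with 1 have "bruhat n A (of_int (sign p) * prod_list (map u [0..<n]))"
    unfolding bruhat_def by blast
  with assms 1(6) show "C = abel_class c" using bruhat_unique by blast
qed

section \<open>Left multiplication by generators\<close>

lemma bruhat_unitriangular_mult:
  assumes W: "upper_unitriangular n W" and A: "bruhat n A c"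
  shows "bruhat n (W * A) c"
proof -
  from A obtain U V p u where 1: "upper_unitriangular n U" "upper_unitriangular n V"
    "p permutes {..<n}" "\<forall>i<n. u i \<noteq> 0" "A = U * monomial_mat n p u * V" "c \<noteq> 0"
    "abel_class c = abel_class (of_int (sign p) * prod_list (map u [0..<n]))" unfolding bruhat_def by blast
  have "W * A = (W * U) * monomial_mat n p u * V"
    using upper_unitriangular_carrier [OF W] upper_unitriangular_carrier [OF 1(1)]
      upper_unitriangular_carrier [OF 1(2)]
    by (simp add: 1(5) sq_assoc [where n = n])
  with upper_unitriangular_mult [OF W 1(1)] 1 show ?thesis unfolding bruhat_def by blast
qed

lemma monomial_mat_diag_mult:
  assumes "\<And>i. i < n \<Longrightarrow> p i < n"
  shows "monomial_mat n id d * monomial_mat n p u = monomial_mat n p (\<lambda>i. d i * u i)"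
  using assms by (subst monomial_mat_mult) (auto simp: monomial_mat_def)

text \<open>
  Diagonal matrices normalize the unitriangular group, so the diagonal factor can be moved past \<open>U\<close>
  onto the monomial matrix.
\<close>

lemma bruhat_diag_mult:
  fixes d :: "nat \<Rightarrow> 'a::division_ring"
  assumes d: "\<And>i. i < n \<Longrightarrow> d i \<noteq> 0" and A: "bruhat n A c"
  shows "bruhat n (monomial_mat n id d * A) (prod_list (map d [0..<n]) * c)"
proof -
  from A obtain U V p u where 1: "upper_unitriangular n U" "upper_unitriangular n V"
    "p permutes {..<n}" "\<forall>i<n. u i \<noteq> 0" "A = U * monomial_mat n p u * V" "c \<noteq> 0"
    "abel_class c = abel_class (of_int (sign p) * prod_list (map u [0..<n]))" unfolding bruhat_def by blast
  note cr = upper_unitriangular_carrier [OF 1(1)] upper_unitriangular_carrier [OF 1(2)]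
  define U' where "U' = mat n n (\<lambda>(i,j). d i * U $$ (i,j) * inverse (d j))"
  have U'c: "U' \<in> carrier_mat n n" by (simp add: U'_def)
  have U': "upper_unitriangular n U'"
    using d upper_unitriangularD [OF 1(1)] by (intro upper_unitriangularI) (auto simp: U'_def)
  have pn: "p i < n" if "i < n" for i
    using permutes_in_image [OF 1(3), of i] that by auto
  have "monomial_mat n id d * U = U' * monomial_mat n id d"
  proof (rule eq_matI)
    fix i j assume "i < dim_row (U' * monomial_mat n id d)" "j < dim_col (U' * monomial_mat n id d)"
    then have ij: "i < n" "j < n" by (auto simp: U'_def)
    then show "(monomial_mat n id d * U) $$ (i,j) = (U' * monomial_mat n id d) $$ (i,j)"
      using mult_monomial_mat_entry [OF U'c ij permutes_id, of d] cr d
      by (auto simp: monomial_mat_mult U'_def mult.assoc)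
  qed (use cr in \<open>auto simp: U'_def\<close>)
  then have eq: "monomial_mat n id d * A = U' * monomial_mat n p (\<lambda>i. d i * u i) * V"
    using cr U'c 1(5)
    by (simp add: monomial_mat_diag_mult [OF pn, symmetric] mult_carrier_mat [of _ n n _ n]
        flip: assoc_mult_mat [of _ n n _ n _ n])
  let ?s = "of_int (sign p) :: 'a" and ?d = "prod_list (map d [0..<n])" and ?u = "prod_list (map u [0..<n])"
  have nz: "?s \<noteq> 0" "?d \<noteq> 0" "?u \<noteq> 0" "prod_list (map (\<lambda>i. d i * u i) [0..<n]) \<noteq> 0"
    using 1(4) d by (auto simp: sign_def prod_list_zero_iff)
  have "abel_class (?s * prod_list (map (\<lambda>i. d i * u i) [0..<n])) = abel_class (?s * (?d * ?u))"
    using nz 1(4) d by (intro abel_class_cong abel_class_prod_list_mult) auto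
  also have "\<dots> = abel_class (?d * (?s * ?u))" using nz by (intro abel_class_swap)
  also have "\<dots> = abel_class (?d * c)" using nz 1(6,7) by (intro abel_class_cong) auto
  finally show ?thesis unfolding bruhat_def
    using U' 1 eq d nz(2) by (intro conjI exI [of _ U'] exI [of _ V] exI [of _ p] exI [of _ "\<lambda>i. d i * u i"]) auto
qed

lemma addrow_monomial_commute:
  fixes u :: "nat \<Rightarrow> 'a::division_ring"
  assumes p: "p permutes {..<n}" and kl: "k < n" "l < n" "k \<noteq> l" and u: "u k \<noteq> 0"
  shows "addrow_mat n b k l * monomial_mat n p u =
    monomial_mat n p u * addrow_mat n (inverse (u k) * b * u l) (p k) (p l)"
proof -
  have pn: "p i < n" if "i < n" for i
    using permutes_in_image [OF p, of i] that by auto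
  have inj: "p i = p j \<longleftrightarrow> i = j" for i j by (rule inj_eq [OF permutes_inj [OF p]])
  have u': "u k * (inverse (u k) * x) = x" for x using u by (simp flip: mult.assoc)
  show ?thesis
    unfolding addrow_mat [OF monomial_mat_carrier kl(2), symmetric]
    by (subst mult_addrow_mat [OF monomial_mat_carrier])
      (auto simp: pn kl inj monomial_mat_def u' mult.assoc intro!: eq_matI)
qed

lemma swaprows_mat_monomial:
  assumes p: "\<And>i. i < n \<Longrightarrow> p i < n" and kl: "k < n" "l < n"
  shows "swaprows_mat n k l * monomial_mat n p u =
    monomial_mat n (p \<circ> transpose k l) (\<lambda>i. u (transpose k l i))"
  unfolding swaprows_mat_mult [OF monomial_mat_carrier kl]
  using kl by (auto simp: monomial_mat_def transpose_def)

lemma bruhat_swaprows_mat_monomial: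
  fixes u :: "nat \<Rightarrow> 'a::division_ring"
  assumes U: "upper_unitriangular n U" and V: "upper_unitriangular n V"
    and p: "p permutes {..<n}" and u: "\<forall>i<n. u i \<noteq> 0" and i: "Suc i < n"
    and c: "c \<noteq> 0" "abel_class c = abel_class (of_int (sign p) * prod_list (map u [0..<n]))"
  shows "bruhat n (U * (swaprows_mat n i (Suc i) * monomial_mat n p u) * V) (- c)"
proof -
  let ?t = "transpose i (Suc i)"
  let ?s = "of_int (sign p) :: 'a" and ?u = "prod_list (map u [0..<n])"
  let ?u' = "prod_list (map (\<lambda>j. u (?t j)) [0..<n])"
  have t: "?t permutes {..<n}" using i by (intro permutes_swap_id) auto
  have pn: "p j < n" if "j < n" for j
    using permutes_in_image [OF p, of j] that by auto
  have tn: "?t j < n" if "j < n" for j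
    using permutes_in_image [OF t, of j] that by auto
  have pp: "permutation p" "permutation ?t" using p t permutation_permutes by blast+
  have nz: "?s \<noteq> 0" "?u \<noteq> 0" "?u' \<noteq> 0"
    using u tn by (auto simp: sign_def prod_list_zero_iff)
  have sg: "of_int (sign (p \<circ> ?t)) = (- 1) * ?s"
    by (simp add: sign_compose [OF pp] sign_swap_id)
  have "abel_class (- c) = abel_class ((- 1) * c)" by simp
  also have "\<dots> = abel_class ((- 1) * (?s * ?u))" using c nz by (intro abel_class_cong) auto
  also have "\<dots> = abel_class (((- 1) * ?s) * ?u)" by simp
  also have "\<dots> = abel_class (((- 1) * ?s) * ?u')"
    using nz abel_class_prod_list_permutes [OF t, of u] u by (intro abel_class_cong [OF refl]) auto
  also have "\<dots> = abel_class (of_int (sign (p \<circ> ?t)) * ?u')" by (simp only: sg)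
  finally have "abel_class (- c) = abel_class (of_int (sign (p \<circ> ?t)) * ?u')" .
  moreover have "swaprows_mat n i (Suc i) * monomial_mat n p u =
      monomial_mat n (p \<circ> ?t) (\<lambda>j. u (?t j))"
    using i pn by (intro swaprows_mat_monomial) auto
  ultimately show ?thesis
    unfolding bruhat_def using U V c u tn permutes_compose [OF t p]
    by (intro conjI exI [of _ U] exI [of _ V] exI [of _ "p \<circ> ?t"] exI [of _ "\<lambda>j. u (?t j)"]) auto
qed

text \<open>
  This is the rank one step that makes the determinant multiplicative. Let \<open>S\<close> swap the rows \<open>i\<close>
  and \<open>i + 1\<close>. Conjugation by \<open>S\<close> preserves the unitriangularity of matrices whose entry at
  \<open>(i, i + 1)\<close> vanishes, so a unitriangular factor with entry \<open>b\<close> there may be replaced by the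
  transvection \<open>E b\<close>. If
  \<open>b = 0\<close> or \<open>p i < p (i + 1)\<close>, then \<open>E b\<close> passes through the monomial matrix as an upper transvection and \<open>S\<close>
  only swaps its rows. Otherwise the identity \<open>[0, 1; 1, b] = [1, b'; 0, 1] [- b', 0; 0, b] [1, 0; b', 1]\<close>
  with \<open>b' = inverse b\<close> replaces \<open>S * E b\<close>; its lower transvection becomes upper when it passes
  through the monomial matrix, and its diagonal factor has class \<open>- 1\<close>, just as \<open>S\<close>.
\<close>

lemma bruhat_adjacent_swap:
  fixes A :: "'a::division_ring mat"
  assumes A: "bruhat n A c" and i: "Suc i < n"
  shows "bruhat n (swaprows_mat n i (Suc i) * A) (- c)"
proof -
  from A obtain U V p u where 1: "upper_unitriangular n U" "upper_unitriangular n V"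
    "p permutes {..<n}" "\<forall>i<n. u i \<noteq> 0" "A = U * monomial_mat n p u * V" "c \<noteq> 0"
    "abel_class c = abel_class (of_int (sign p) * prod_list (map u [0..<n]))" unfolding bruhat_def by blast
  let ?j = "Suc i" and ?S = "swaprows_mat n i (Suc i) :: 'a mat" and ?M = "monomial_mat n p u"
  have ij: "i < n" "i \<noteq> ?j" using i by auto
  note cr = upper_unitriangular_carrier [OF 1(1)] upper_unitriangular_carrier [OF 1(2)]
  have pn: "p j < n" if "j < n" for j
    using permutes_in_image [OF 1(3), of j] that by auto
  have pij: "p i \<noteq> p ?j" using inj_eq [OF permutes_inj [OF 1(3)]] by simp
  define b where "b = U $$ (i, ?j)"
  let ?E = "\<lambda>x. addrow_mat n x i ?j"
  define U2 where "U2 = U * ?E (- b)"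
  define W where "W = ?S * U2 * ?S"
  have U2c: "U2 \<in> carrier_mat n n" using cr by (simp add: U2_def mult_carrier_mat [of _ n n])
  have U2: "upper_unitriangular n U2"
    unfolding U2_def by (intro upper_unitriangular_mult 1 upper_unitriangular_addrow_mat) (use i in auto)
  have U20: "U2 $$ (i, ?j) = 0"
    unfolding U2_def mult_addrow_mat [OF cr(1) ij(1) i ij(2)]
    using ij i upper_unitriangularD(1) [OF 1(1) ij(1)] by (simp add: b_def)
  have W: "upper_unitriangular n W"
    unfolding W_def swaprows_mat_conj [OF U2c ij(1) i]
    by (rule upper_unitriangularI)
       (use i U20 upper_unitriangularD [OF U2] in \<open>auto simp: transpose_def\<close>)
  have Wc: "W \<in> carrier_mat n n" by (rule upper_unitriangular_carrier [OF W])
  have "U = U2 * ?E b"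
    using cr addrow_mat_inverse(2) [OF ij(1) i ij(2), of b] by (simp add: U2_def sq_assoc [where n = n])
  also have "?S * \<dots> = W * (?S * ?E b)"
  proof -
    have SS: "?S * ?S = 1\<^sub>m n" by (rule swaprows_mat_inv [OF ij(1) i])
    have "W * (?S * ?E b) = ?S * (U2 * ((?S * ?S) * ?E b))"
      using U2c by (simp add: W_def sq_assoc [where n = n])
    then show ?thesis unfolding SS by simp
  qed
  finally have SU: "?S * U = W * (?S * ?E b)" .
  have SA: "?S * A = W * (?S * (?E b * ?M * V))"
  proof -
    have "?S * A = (?S * U) * (?M * V)" using cr by (simp add: 1(5) sq_assoc [where n = n])
    also have "\<dots> = W * (?S * (?E b * ?M * V))" using cr Wc by (simp add: SU sq_assoc [where n = n])
    finally show ?thesis .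
  qed
  show ?thesis
  proof (cases "p i < p ?j \<or> b = 0")
    case True
    let ?x = "inverse (u i) * b * u ?j"
    let ?F = "addrow_mat n ?x (p i) (p ?j)"
    have F: "upper_unitriangular n ?F"
    proof (cases "b = 0")
      case True
      then have "?F = 1\<^sub>m n" by (auto intro!: eq_matI)
      then show ?thesis by (simp add: upper_unitriangular_one)
    qed (use True pn i in \<open>auto intro!: upper_unitriangular_addrow_mat\<close>)
    have "?E b * ?M = ?M * ?F"
      using addrow_monomial_commute [OF 1(3) ij(1) i ij(2)] 1(4) ij by blast
    then have "?S * A = W * (?S * ?M) * (?F * V)"
      using cr Wc by (simp add: SA sq_assoc [where n = n])
    then show ?thesis
      using bruhat_swaprows_mat_monomial [OF W upper_unitriangular_mult [OF F 1(2)] 1(3,4) i 1(6,7)] by simp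
  next
    case False
    with pij have lt: "p ?j < p i" and b: "b \<noteq> 0" by auto
    define d where "d = (\<lambda>k. if k = i then - inverse b else if k = ?j then b else 1)"
    let ?D = "monomial_mat n id d"
    let ?x = "inverse (u ?j) * inverse b * u i"
    let ?F = "addrow_mat n ?x (p ?j) (p i)"
    have F: "upper_unitriangular n ?F"
      using lt pn ij by (intro upper_unitriangular_addrow_mat) auto
    have bb: "b * (inverse b * x) = x" "inverse b * (b * x) = x" for x
      using b by (simp_all flip: mult.assoc)
    have eq: "?S * (?E b * ?M) = ?E (inverse b) * (?D * (addrow_mat n (inverse b) ?j i * ?M))"
      using ij i pn
      by (simp add: swaprows_mat [symmetric, of _ n n] addrow_mat [symmetric, of _ n n]
          monomial_mat_mult [of _ _ n])
        (auto intro!: eq_matI simp: d_def bb algebra_simps)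
    have comm: "addrow_mat n (inverse b) ?j i * ?M = ?M * ?F"
      using addrow_monomial_commute [OF 1(3) i ij(1) ij(2) [symmetric]] 1(4) i by blast
    have "?S * A = W * (?E (inverse b) * (?D * (?M * (?F * V))))"
    proof -
      have "?S * A = W * ((?S * (?E b * ?M)) * V)" using cr Wc by (simp add: SA sq_assoc [where n = n])
      also have "\<dots> = W * (?E (inverse b) * (?D * (?M * (?F * V))))"
        unfolding eq comm using cr Wc by (simp add: sq_assoc [where n = n])
      finally show ?thesis .
    qed
    moreover have "bruhat n (?M * (?F * V)) c"
      unfolding bruhat_def using 1 upper_unitriangular_mult [OF F 1(2)] cr
      by (intro conjI exI [of _ "1\<^sub>m n"] exI [of _ "?F * V"] exI [of _ p] exI [of _ u])
        (auto simp: upper_unitriangular_one)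
    then have "bruhat n (?D * (?M * (?F * V))) (prod_list (map d [0..<n]) * c)"
      using b by (intro bruhat_diag_mult) (auto simp: d_def)
    moreover have "prod_list (map d [0..<n]) = - 1"
    proof -
      have "[0..<n] = [0..<i] @ [i, ?j] @ [Suc ?j..<n]"
        using i by (metis Suc_leI append_Cons append_Nil less_or_eq_imp_le upt_add_eq_append upt_conv_Cons
            ij(1) le_add_diff_inverse zero_le)
      moreover have "prod_list (map d xs) = 1" if "i \<notin> set xs" "?j \<notin> set xs" for xs
        using that by (induction xs) (auto simp: d_def)
      ultimately show ?thesis using b by (simp add: d_def)
    qed
    ultimately show ?thesis
      using bruhat_unitriangular_mult [OF W bruhat_unitriangular_mult [OF
        upper_unitriangular_addrow_mat [OF lessI i]]] by simp
  qed
qed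

section \<open>Products of generators and their determinant\<close>

text \<open>
  Products of generators of the general linear group, together with a representative of the
  determinant. The rule \<open>cong\<close> makes the second argument a representative of a class, so that the
  determinant \<open>1\<close> can be stated as \<open>gl_word n A 1\<close>.
\<close>

inductive gl_word :: "nat \<Rightarrow> 'a::division_ring mat \<Rightarrow> 'a \<Rightarrow> bool" for n where
  one: "gl_word n (1\<^sub>m n) 1"
| unitri: "upper_unitriangular n U \<Longrightarrow> gl_word n A c \<Longrightarrow> gl_word n (U * A) c"
| swap: "Suc i < n \<Longrightarrow> gl_word n A c \<Longrightarrow> gl_word n (swaprows_mat n i (Suc i) * A) (- c)"
| diag: "(\<And>i. i < n \<Longrightarrow> d i \<noteq> 0) \<Longrightarrow> gl_word n A c \<Longrightarrow>
    gl_word n (monomial_mat n id d * A) (prod_list (map d [0..<n]) * c)"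
| cong: "gl_word n A c \<Longrightarrow> abel_class c = abel_class d \<Longrightarrow> d \<noteq> 0 \<Longrightarrow> gl_word n A d"

lemma gl_word_carrier: "gl_word n A c \<Longrightarrow> A \<in> carrier_mat n n"
  by (induction rule: gl_word.induct) (auto simp: mult_carrier_mat [of _ n n] upper_unitriangular_carrier)

lemma gl_word_nonzero: "gl_word n A c \<Longrightarrow> c \<noteq> 0"
  by (induction rule: gl_word.induct) (auto simp: prod_list_zero_iff)

lemma bruhat_one: "bruhat n (1\<^sub>m n) (1 :: 'a::division_ring)"
proof -
  have "prod_list (map (\<lambda>_. 1 :: 'a) xs) = 1" for xs :: "nat list" by (induction xs) auto
  then show ?thesis unfolding bruhat_def
    by (intro conjI exI [of _ "1\<^sub>m n"] exI [of _ id] exI [of _ "\<lambda>_. 1"])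
      (auto simp: upper_unitriangular_one permutes_id monomial_mat_def intro!: eq_matI)
qed

lemma gl_word_bruhat: "gl_word n A c \<Longrightarrow> bruhat n A c"
proof (induction rule: gl_word.induct)
  case (cong A c d)
  then show ?case unfolding bruhat_def by auto
qed (auto intro: bruhat_one bruhat_unitriangular_mult bruhat_adjacent_swap bruhat_diag_mult)

text \<open>
  Since \<open>gl_word\<close> is visibly multiplicative, this is where well-definedness of the determinant on
  products comes from.
\<close>

lemma gl_word_unique: "gl_word n A c \<Longrightarrow> gl_word n A d \<Longrightarrow> abel_class c = abel_class d"
  using gl_word_bruhat bruhat_unique by blast

lemma gl_word_mult:
  "gl_word n A c \<Longrightarrow> gl_word n B d \<Longrightarrow> gl_word n (A * B) (c * d)"
proof (induction rule: gl_word.induct)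
  case one
  then show ?case using gl_word_carrier [OF one] by simp
next
  case (unitri U A c)
  then show ?case
    using gl_word.unitri [OF unitri(1) unitri.IH] gl_word_carrier upper_unitriangular_carrier
    by (metis assoc_mult_mat)
next
  case (swap i A c)
  then show ?case
    using gl_word.swap [OF swap(1) swap.IH] gl_word_carrier [OF swap(2)] gl_word_carrier [OF swap(4)]
    by (simp add: sq_assoc [where n = n])
next
  case (diag e A c)
  then show ?case
    using gl_word.diag [OF diag(1) diag.IH] gl_word_carrier [OF diag(2)] gl_word_carrier [OF diag(4)]
    by (simp add: sq_assoc [where n = n] mult.assoc)
next
  case (cong A c c')
  have nz: "c \<noteq> 0" "d \<noteq> 0" using gl_word_nonzero cong by blast+
  then have "abel_class (c * d) = abel_class (c' * d)" using cong by (intro abel_class_cong) auto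
  then show ?case using gl_word.cong [OF cong.IH] cong nz by auto
qed

lemma gl_word_unitri: "upper_unitriangular n U \<Longrightarrow> gl_word n U 1"
  using gl_word.unitri [OF _ gl_word.one] by (metis upper_unitriangular_carrier right_mult_one_mat)

lemma gl_word_diag:
  "(\<And>i. i < n \<Longrightarrow> d i \<noteq> 0) \<Longrightarrow> gl_word n (monomial_mat n id d) (prod_list (map d [0..<n]))"
  using gl_word.diag [OF _ gl_word.one, of n d] right_mult_one_mat [OF monomial_mat_carrier, of n id d] by simp

lemma gl_word_adjacent: "Suc i < n \<Longrightarrow> gl_word n (swaprows_mat n i (Suc i) :: 'a::division_ring mat) (- 1)"
  using gl_word.swap [OF _ gl_word.one, of i n] right_mult_one_mat [OF swaprows_mat_carrier, of n i "Suc i"] by simp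

lemma gl_word_inverse:
  assumes "gl_word n A c"
  shows "\<exists>B d. gl_word n B d \<and> A * B = 1\<^sub>m n \<and> B * A = 1\<^sub>m n"
proof -
  have step: "\<exists>B d. gl_word n B d \<and> (G * A) * B = 1\<^sub>m n \<and> B * (G * A) = 1\<^sub>m n"
    if "\<exists>B d. gl_word n B d \<and> A * B = 1\<^sub>m n \<and> B * A = 1\<^sub>m n" and G: "G \<in> carrier_mat n n"
      and A: "A \<in> carrier_mat n n" and H: "gl_word n H e" "G * H = 1\<^sub>m n" "H * G = 1\<^sub>m n"
    for A G H :: "'a mat" and e
  proof -
    from that(1) obtain B d where B: "gl_word n B d" "A * B = 1\<^sub>m n" "B * A = 1\<^sub>m n" by blast
    note cr = G A gl_word_carrier [OF B(1)] gl_word_carrier [OF H(1)]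
    have "(G * A) * (B * H) = G * ((A * B) * H)" "(B * H) * (G * A) = B * ((H * G) * A)"
      using cr by (simp_all add: sq_assoc [where n = n])
    with B H cr have "(G * A) * (B * H) = 1\<^sub>m n" "(B * H) * (G * A) = 1\<^sub>m n" by simp_all
    with gl_word_mult [OF B(1) H(1)] show ?thesis by blast
  qed
  from assms show ?thesis
  proof (induction rule: gl_word.induct)
    case one
    show ?case using gl_word.one by (intro exI [of _ "1\<^sub>m n"] exI [of _ 1]) auto
  next
    case (unitri U A c)
    from upper_unitriangular_inverse [OF unitri(1)] obtain V where
      "upper_unitriangular n V" "U * V = 1\<^sub>m n" "V * U = 1\<^sub>m n" .
    then show ?case
      using step [OF unitri.IH upper_unitriangular_carrier [OF unitri(1)] gl_word_carrier [OF unitri(2)]]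
        gl_word_unitri by blast
  next
    case (swap i A c)
    have "swaprows_mat n i (Suc i) * swaprows_mat n i (Suc i) = (1\<^sub>m n :: 'a mat)"
      using swap(1) by (intro swaprows_mat_inv) auto
    then show ?case
      using step [OF swap.IH swaprows_mat_carrier gl_word_carrier [OF swap(2)] gl_word_adjacent [OF swap(1)]]
      by blast
  next
    case (diag d A c)
    have "gl_word n (monomial_mat n id (\<lambda>i. inverse (d i))) (prod_list (map (\<lambda>i. inverse (d i)) [0..<n]))"
      using diag(1) by (intro gl_word_diag) auto
    moreover have "monomial_mat n id d * monomial_mat n id (\<lambda>i. inverse (d i)) = 1\<^sub>m n"
      "monomial_mat n id (\<lambda>i. inverse (d i)) * monomial_mat n id d = 1\<^sub>m n"
      using diag(1) by (subst monomial_mat_diag_mult; auto simp: monomial_mat_def)+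
    ultimately show ?case
      using step [OF diag.IH monomial_mat_carrier gl_word_carrier [OF diag(2)]] by blast
  next
    case (cong A c d)
    then show ?case by blast
  qed
qed

abbreviation one_block :: "nat \<Rightarrow> 'a::division_ring mat \<Rightarrow> 'a mat" where
  "one_block m A \<equiv> four_block_mat (1\<^sub>m 1) (0\<^sub>m 1 m) (0\<^sub>m m 1) A"

lemma one_block_mult:
  assumes "A \<in> carrier_mat m m" "B \<in> carrier_mat m m"
  shows "one_block m (A * B) = one_block m A * one_block m B"
  using assms by (subst mult_four_block_mat [of _ 1 1 _ m _ m _ _ 1 _ m]) auto

lemma one_block_one: "one_block m (1\<^sub>m m) = 1\<^sub>m (Suc m)"
  by (metis four_block_one_mat plus_1_eq_Suc)

lemma gl_word_one_block:
  "gl_word m A c \<Longrightarrow> gl_word (Suc m) (one_block m A) c"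
proof (induction rule: gl_word.induct)
  case one
  show ?case unfolding one_block_one by (rule gl_word.one)
next
  case (unitri U A c)
  have "upper_unitriangular (Suc m) (one_block m U)"
    by (rule upper_unitriangular_four_block) (use unitri in auto)
  from gl_word.unitri [OF this unitri.IH] show ?case
    using one_block_mult [OF upper_unitriangular_carrier [OF unitri(1)] gl_word_carrier [OF unitri(2)]] by simp
next
  case (swap i A c)
  have "one_block m (swaprows_mat m i (Suc i)) = (swaprows_mat (Suc m) (Suc i) (Suc (Suc i)) :: 'a mat)"
  proof (rule eq_matI)
    fix r s
    assume "r < dim_row (swaprows_mat (Suc m) (Suc i) (Suc (Suc i)) :: 'a mat)"
      and "s < dim_col (swaprows_mat (Suc m) (Suc i) (Suc (Suc i)) :: 'a mat)"
    then show "one_block m (swaprows_mat m i (Suc i)) $$ (r, s) =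
      (swaprows_mat (Suc m) (Suc i) (Suc (Suc i)) :: 'a mat) $$ (r, s)"
      by (cases r; cases s) simp_all
  qed simp_all
  with gl_word.swap [OF _ swap.IH, of "Suc i"] swap(1) show ?case
    using one_block_mult [OF swaprows_mat_carrier gl_word_carrier [OF swap(2)]] by simp
next
  case (diag d A c)
  let ?d = "case_nat 1 d"
  have "one_block m (monomial_mat m id d) = monomial_mat (Suc m) id ?d"
    by (rule eq_matI) (auto simp: monomial_mat_def split: nat.splits)
  moreover have "map ?d [0..<Suc m] = 1 # map d [0..<m]"
    unfolding upt_conv_Cons [OF zero_less_Suc] map_Suc_upt [symmetric] by simp
  moreover have "gl_word (Suc m) (monomial_mat (Suc m) id ?d * one_block m A) (prod_list (map ?d [0..<Suc m]) * c)"
    using diag.IH diag(1) by (intro gl_word.diag) (auto split: nat.split)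
  ultimately show ?case
    using one_block_mult [OF monomial_mat_carrier gl_word_carrier [OF diag(2)]] by (simp del: upt_Suc)
next
  case (cong A c d)
  then show ?case by (auto intro: gl_word.cong)
qed

text \<open>
  The swap of \<open>0\<close> and \<open>j + 1\<close> is the conjugate of the swap of \<open>0\<close> and \<open>j\<close> by an adjacent one.
\<close>

lemma gl_word_swap_first:
  "j < n \<Longrightarrow> \<exists>c. gl_word n (swaprows_mat n 0 j :: 'a::division_ring mat) c"
proof (induction j)
  case 0
  have "swaprows_mat n 0 0 = (1\<^sub>m n :: 'a mat)" by (auto intro!: eq_matI)
  then show ?case using gl_word.one by auto
next
  case (Suc j)
  show ?case
  proof (cases "j = 0")
    case True
    then show ?thesis using gl_word_adjacent Suc.prems by auto
  next
    case False
    let ?S = "swaprows_mat n j (Suc j) :: 'a mat"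
    from Suc obtain c where c: "gl_word n (swaprows_mat n 0 j :: 'a mat) c" by auto
    have "?S * swaprows_mat n 0 j * ?S = swaprows_mat n 0 (Suc j)"
      using False Suc.prems
      by (subst swaprows_mat_conj) (auto simp: transpose_def intro!: eq_matI)
    then show ?thesis
      using gl_word_mult [OF gl_word_mult [OF gl_word_adjacent [OF Suc.prems] c] gl_word_adjacent [OF Suc.prems]]
      by auto
  qed
qed

text \<open>
  Conjugation by the swap of the first and the last index turns this lower unitriangular matrix into
  an upper one; the determinant of the swap enters twice and cancels, since the swap is an involution.
\<close>

lemma gl_word_first_column:
  fixes C :: "'a::division_ring mat"
  assumes C: "C \<in> carrier_mat m 1"
  shows "gl_word (Suc m) (four_block_mat (1\<^sub>m 1) (0\<^sub>m 1 m) C (1\<^sub>m m)) 1"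
proof -
  let ?n = "Suc m"
  let ?L = "four_block_mat (1\<^sub>m 1) (0\<^sub>m 1 m) C (1\<^sub>m m)"
  let ?S = "swaprows_mat ?n 0 m :: 'a mat"
  have Lc: "?L \<in> carrier_mat ?n ?n" using C by auto
  have "upper_unitriangular ?n (?S * ?L * ?S)"
    unfolding swaprows_mat_conj [OF Lc zero_less_Suc lessI]
    by (rule upper_unitriangularI) (use C in \<open>auto simp: transpose_def\<close>)
  then have U: "gl_word ?n (?S * ?L * ?S) 1" by (rule gl_word_unitri)
  from gl_word_swap_first [of m ?n] obtain s where s: "gl_word ?n ?S s" by auto
  have SS: "?S * ?S = 1\<^sub>m ?n" by (rule swaprows_mat_inv) auto
  have nz: "s \<noteq> 0" using gl_word_nonzero [OF s] .
  have "?S * (?S * ?L * ?S) * ?S = (?S * ?S) * (?L * (?S * ?S))"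
    using Lc by (simp add: sq_assoc [where n = ?n])
  also have "\<dots> = ?L" using Lc unfolding SS by simp
  finally have "gl_word ?n ?L (s * 1 * s)"
    using gl_word_mult [OF gl_word_mult [OF s U] s] by simp
  moreover have "abel_class (s * s) = abel_class 1"
    using gl_word_unique [OF gl_word_mult [OF s s]] SS gl_word.one by metis
  ultimately show ?thesis by (auto intro: gl_word.cong)
qed

text \<open>
  Similarity by a product of generators. The determinants of \<open>P\<close> and \<open>Q\<close> are left open: as \<open>P\<close> and
  \<open>Q\<close> are inverse to each other they cancel.
\<close>

definition gl_similar :: "nat \<Rightarrow> 'a::division_ring mat \<Rightarrow> 'a mat \<Rightarrow> bool" where
  "gl_similar n A B \<longleftrightarrow> (\<exists>P Q c d. B \<in> carrier_mat n n \<and> gl_word n P c \<and> gl_word n Q d \<and>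
     P * Q = 1\<^sub>m n \<and> Q * P = 1\<^sub>m n \<and> A = P * B * Q)"

lemma gl_similarI:
  assumes "B \<in> carrier_mat n n" "gl_word n P c" "gl_word n Q d" "P * Q = 1\<^sub>m n" "Q * P = 1\<^sub>m n" "A = P * B * Q"
  shows "gl_similar n A B"
  using assms unfolding gl_similar_def by blast

lemma gl_similar_refl: "A \<in> carrier_mat n n \<Longrightarrow> gl_similar n A A"
  by (rule gl_similarI [OF _ gl_word.one gl_word.one]) auto

lemma gl_similar_trans:
  assumes "gl_similar n A B" "gl_similar n B C"
  shows "gl_similar n A C"
proof -
  from assms(1) obtain P Q c d where 1: "gl_word n P c" "gl_word n Q d"
    "P * Q = 1\<^sub>m n" "Q * P = 1\<^sub>m n" "A = P * B * Q" unfolding gl_similar_def by blast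
  from assms(2) obtain R S e f where 2: "C \<in> carrier_mat n n" "gl_word n R e" "gl_word n S f"
    "R * S = 1\<^sub>m n" "S * R = 1\<^sub>m n" "B = R * C * S" unfolding gl_similar_def by blast
  note cr = 1(1,2)[THEN gl_word_carrier] 2(2,3)[THEN gl_word_carrier] 2(1)
  have "(P * R) * (S * Q) = P * ((R * S) * Q)" "(S * Q) * (P * R) = S * ((Q * P) * R)"
    using cr by (simp_all add: sq_assoc [where n = n])
  moreover have "A = (P * R) * C * (S * Q)"
    using cr by (simp add: 1(5) 2(6) sq_assoc [where n = n])
  ultimately show ?thesis
    using gl_similarI [OF 2(1) gl_word_mult [OF 1(1) 2(2)] gl_word_mult [OF 2(3) 1(2)]] cr 1 2 by simp
qed

lemma gl_similar_conj:
  assumes P: "gl_word n P c" "gl_word n Q d" "P * Q = 1\<^sub>m n" "Q * P = 1\<^sub>m n" and A: "A \<in> carrier_mat n n"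
  shows "gl_similar n A (P * A * Q)"
proof (rule gl_similarI [OF _ P(2,1,4,3)])
  note cr = A gl_word_carrier [OF P(1)] gl_word_carrier [OF P(2)]
  have "Q * (P * A * Q) * P = (Q * P) * (A * (Q * P))" using cr by (simp add: sq_assoc [where n = n])
  then show "A = Q * (P * A * Q) * P" using cr P by simp
qed (use A gl_word_carrier [OF P(1)] gl_word_carrier [OF P(2)] in \<open>simp add: mult_carrier_mat [of _ n n]\<close>)

lemma gl_similar_unitri:
  assumes U: "upper_unitriangular n U" "upper_unitriangular n V" "U * V = 1\<^sub>m n" and A: "A \<in> carrier_mat n n"
  shows "gl_similar n A (U * A * V)"
proof -
  from upper_unitriangular_inverse [OF U(1)] obtain W where W: "upper_unitriangular n W" "W * U = 1\<^sub>m n" .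
  note cr = U(1,2) W(1)
  note cr = cr [THEN upper_unitriangular_carrier]
  have "W * (U * V) = (W * U) * V" using cr by (simp add: sq_assoc [where n = n])
  then have "W = V" using cr U(3) W(2) by simp
  then show ?thesis using gl_similar_conj [OF gl_word_unitri [OF U(1)] gl_word_unitri [OF U(2)] U(3)] W(2) A by blast
qed

section \<open>Triangular factorization up to similarity\<close>

definition central_scalar :: "nat \<Rightarrow> 'a::division_ring mat \<Rightarrow> bool" where
  "central_scalar n A \<longleftrightarrow> (\<exists>a. (\<forall>x. a * x = x * a) \<and> A = monomial_mat n id (\<lambda>_. a))"

lemma unipotent_one: "unipotent_mat n (1\<^sub>m n :: 'a::division_ring mat)"
  unfolding unipotent_mat_def by (intro conjI exI [of _ 1]) (auto intro!: eq_matI)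

lemma uminus_zero_mat [simp]: "- 0\<^sub>m r s = (0\<^sub>m r s :: 'a::group_add mat)"
  by (rule eq_matI) auto

lemma four_block_Suc_carrier:
  assumes "A \<in> carrier_mat 1 1" "D \<in> carrier_mat m m"
  shows "four_block_mat A B C D \<in> carrier_mat (Suc m) (Suc m)"
  using four_block_carrier_mat [OF assms] by simp

lemma one_minus_four_block:
  fixes X :: "'a::division_ring mat"
  assumes "R \<in> carrier_mat 1 m" "C \<in> carrier_mat m 1" "X \<in> carrier_mat m m"
  shows "1\<^sub>m (Suc m) - four_block_mat (1\<^sub>m 1) R C X = four_block_mat (0\<^sub>m 1 1) (- R) (- C) (1\<^sub>m m - X)"
  using assms by (intro eq_matI) auto

text \<open>
  The powers of \<open>[0, 0; - C, N]\<close>, where \<open>N = 1 - X\<close>, have the form \<open>[0, 0; *, N ^ j]\<close>, and one more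
  factor than needed for \<open>N\<close> kills the first column as well.
\<close>

lemma unipotent_lower_block:
  fixes X :: "'a::division_ring mat"
  assumes C: "C \<in> carrier_mat m 1" and X: "unipotent_mat m X"
  shows "unipotent_mat (Suc m) (four_block_mat (1\<^sub>m 1) (0\<^sub>m 1 m) C X)"
proof -
  from X obtain k where Xc: "X \<in> carrier_mat m m" and k: "(1\<^sub>m m - X) ^\<^sub>m k = 0\<^sub>m m m"
    unfolding unipotent_mat_def by blast
  let ?M = "1\<^sub>m m - X"
  let ?N = "four_block_mat (0\<^sub>m 1 1) (0\<^sub>m 1 m) (- C) ?M"
  have Mc: "?M \<in> carrier_mat m m" by (rule minus_carrier_mat [OF Xc])
  have Mk: "?M ^\<^sub>m j \<in> carrier_mat m m" for j using Mc by (rule pow_carrier_mat)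
  have Nc: "?N \<in> carrier_mat (Suc m) (Suc m)" by (rule four_block_Suc_carrier [OF _ Mc]) simp
  have N: "1\<^sub>m (Suc m) - four_block_mat (1\<^sub>m 1) (0\<^sub>m 1 m) C X = ?N"
    using one_minus_four_block [of "0\<^sub>m 1 m" m C X] C Xc by (simp del: One_nat_def)
  have step: "four_block_mat (0\<^sub>m 1 1) (0\<^sub>m 1 m) Z Y * ?N =
      four_block_mat (0\<^sub>m 1 1) (0\<^sub>m 1 m) (Y * (- C)) (Y * ?M)"
    if "Z \<in> carrier_mat m 1" "Y \<in> carrier_mat m m" for Z Y
    using that C Mc
    by (subst mult_four_block_mat [of _ 1 1 _ m _ m _ _ 1 _ m])
      (auto simp: left_mult_zero_mat [OF Mc] left_add_zero_mat [of _ 1 m] left_add_zero_mat [of _ m m] simp del: One_nat_def)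
  have pow: "\<exists>Z. Z \<in> carrier_mat m 1 \<and> ?N ^\<^sub>m Suc j = four_block_mat (0\<^sub>m 1 1) (0\<^sub>m 1 m) Z (?M ^\<^sub>m Suc j)" for j
  proof (induction j)
    case 0
    have "?N ^\<^sub>m Suc 0 = ?N" "?M ^\<^sub>m Suc 0 = ?M"
      using Nc Mc by (simp_all add: left_mult_one_mat [of _ "Suc m" "Suc m"])
    then show ?case using C by (intro exI [of _ "- C"]) simp
  next
    case (Suc j)
    then obtain Z where Z: "Z \<in> carrier_mat m 1"
      "?N ^\<^sub>m Suc j = four_block_mat (0\<^sub>m 1 1) (0\<^sub>m 1 m) Z (?M ^\<^sub>m Suc j)" by blast
    have "?N ^\<^sub>m Suc (Suc j) = ?N ^\<^sub>m Suc j * ?N" by simp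
    also have "\<dots> = four_block_mat (0\<^sub>m 1 1) (0\<^sub>m 1 m) (?M ^\<^sub>m Suc j * (- C)) (?M ^\<^sub>m Suc j * ?M)"
      unfolding Z(2) by (rule step [OF Z(1) Mk])
    also have "?M ^\<^sub>m Suc j * ?M = ?M ^\<^sub>m Suc (Suc j)" by simp
    finally show ?case using C Mk [of "Suc j"] by (intro exI conjI) auto
  qed
  from pow [of k] obtain Z where Z: "Z \<in> carrier_mat m 1"
    "?N ^\<^sub>m Suc k = four_block_mat (0\<^sub>m 1 1) (0\<^sub>m 1 m) Z (?M ^\<^sub>m Suc k)" by blast
  have Mk0: "?M ^\<^sub>m Suc k = 0\<^sub>m m m" using k left_mult_zero_mat [OF Mc] by simp
  have "?N ^\<^sub>m Suc (Suc k) = ?N ^\<^sub>m Suc k * ?N" by simp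
  also have "\<dots> = four_block_mat (0\<^sub>m 1 1) (0\<^sub>m 1 m) (0\<^sub>m m m * (- C)) (0\<^sub>m m m * ?M)"
    unfolding Z(2) Mk0 by (rule step [OF Z(1)]) simp
  also have "\<dots> = 0\<^sub>m (Suc m) (Suc m)" unfolding left_mult_zero_mat [OF Mc] using C by (auto intro!: eq_matI)
  finally have "(1\<^sub>m (Suc m) - four_block_mat (1\<^sub>m 1) (0\<^sub>m 1 m) C X) ^\<^sub>m Suc (Suc k) = 0\<^sub>m (Suc m) (Suc m)"
    unfolding N .
  then show ?thesis unfolding unipotent_mat_def using four_block_Suc_carrier [OF one_carrier_mat Xc] by blast
qed

lemma unipotent_upper_block:
  fixes X :: "'a::division_ring mat"
  assumes R: "R \<in> carrier_mat 1 m" and X: "unipotent_mat m X"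
  shows "unipotent_mat (Suc m) (four_block_mat (1\<^sub>m 1) R (0\<^sub>m m 1) X)"
proof -
  from X obtain k where Xc: "X \<in> carrier_mat m m" and k: "(1\<^sub>m m - X) ^\<^sub>m k = 0\<^sub>m m m"
    unfolding unipotent_mat_def by blast
  let ?M = "1\<^sub>m m - X"
  let ?N = "four_block_mat (0\<^sub>m 1 1) (- R) (0\<^sub>m m 1) ?M"
  have Mc: "?M \<in> carrier_mat m m" by (rule minus_carrier_mat [OF Xc])
  have Mk: "?M ^\<^sub>m j \<in> carrier_mat m m" for j using Mc by (rule pow_carrier_mat)
  have Nc: "?N \<in> carrier_mat (Suc m) (Suc m)" by (rule four_block_Suc_carrier [OF _ Mc]) simp
  have N: "1\<^sub>m (Suc m) - four_block_mat (1\<^sub>m 1) R (0\<^sub>m m 1) X = ?N"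
    using one_minus_four_block [of R m "0\<^sub>m m 1" X] R Xc by (simp del: One_nat_def)
  have step: "four_block_mat (0\<^sub>m 1 1) Z (0\<^sub>m m 1) Y * ?N =
      four_block_mat (0\<^sub>m 1 1) (Z * ?M) (0\<^sub>m m 1) (Y * ?M)"
    if "Z \<in> carrier_mat 1 m" "Y \<in> carrier_mat m m" for Z Y
    using that R Mc
    by (subst mult_four_block_mat [of _ 1 1 _ m _ m _ _ 1 _ m])
      (auto simp: left_mult_zero_mat [OF Mc] left_add_zero_mat [of _ 1 m] left_add_zero_mat [of _ m m] simp del: One_nat_def)
  have pow: "?N ^\<^sub>m Suc j = four_block_mat (0\<^sub>m 1 1) ((- R) * ?M ^\<^sub>m j) (0\<^sub>m m 1) (?M ^\<^sub>m Suc j)" for j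
  proof (induction j)
    case 0
    show ?case
      using Nc Mc R Xc by (simp add: left_mult_one_mat [of _ "Suc m" "Suc m"] right_mult_one_mat [of "- R" 1 m] del: One_nat_def uminus_mult_left_mat)
  next
    case (Suc j)
    have "?N ^\<^sub>m Suc (Suc j) = ?N ^\<^sub>m Suc j * ?N" by simp
    also have "\<dots> = four_block_mat (0\<^sub>m 1 1) (((- R) * ?M ^\<^sub>m j) * ?M) (0\<^sub>m m 1) (?M ^\<^sub>m Suc j * ?M)"
      unfolding Suc.IH by (rule step) (use R Mk [of j] Mk [of "Suc j"] in auto)
    also have "((- R) * ?M ^\<^sub>m j) * ?M = (- R) * ?M ^\<^sub>m Suc j"
      using R Mk [of j] Mc by (simp add: assoc_mult_mat [of _ 1 m _ m _ m] del: uminus_mult_left_mat)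
    also have "?M ^\<^sub>m Suc j * ?M = ?M ^\<^sub>m Suc (Suc j)" by simp
    finally show ?case .
  qed
  have "?N ^\<^sub>m Suc k = four_block_mat (0\<^sub>m 1 1) ((- R) * 0\<^sub>m m m) (0\<^sub>m m 1) (0\<^sub>m m m * ?M)"
    unfolding pow by (simp add: k)
  also have "\<dots> = 0\<^sub>m (Suc m) (Suc m)" unfolding left_mult_zero_mat [OF Mc] using R by (auto intro!: eq_matI)
  finally have "(1\<^sub>m (Suc m) - four_block_mat (1\<^sub>m 1) R (0\<^sub>m m 1) X) ^\<^sub>m Suc k = 0\<^sub>m (Suc m) (Suc m)"
    unfolding N .
  then show ?thesis unfolding unipotent_mat_def using four_block_Suc_carrier [OF one_carrier_mat Xc] by blast
qed

lemma four_block_inject: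
  assumes "four_block_mat A B C D = four_block_mat A' B' C' D'"
    and c: "A \<in> carrier_mat p q" "A' \<in> carrier_mat p q" "B \<in> carrier_mat p s" "B' \<in> carrier_mat p s"
      "C \<in> carrier_mat r q" "C' \<in> carrier_mat r q" "D \<in> carrier_mat r s" "D' \<in> carrier_mat r s"
  shows "B = B'" "D = D'"
proof -
  have e: "four_block_mat A B C D $$ (i,j) = four_block_mat A' B' C' D' $$ (i,j)" for i j
    using assms(1) by simp
  show "B = B'"
  proof (rule eq_matI)
    fix i j assume "i < dim_row B'" "j < dim_col B'"
    then show "B $$ (i,j) = B' $$ (i,j)" using e [of i "q + j"] c by auto
  qed (use c in auto)
  show "D = D'"
  proof (rule eq_matI)
    fix i j assume "i < dim_row D'" "j < dim_col D'"
    then show "D $$ (i,j) = D' $$ (i,j)" using e [of "p + i" "q + j"] c by auto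
  qed (use c in auto)
qed

text \<open>
  One-sided invertibility passes to Schur complements by a direct block computation, and it has the
  two consequences that elimination needs: no nonzero row annihilates the matrix, and the final pivot
  is nonzero.
\<close>

definition right_invertible :: "nat \<Rightarrow> 'a::division_ring mat \<Rightarrow> bool" where
  "right_invertible n A \<longleftrightarrow> A \<in> carrier_mat n n \<and> (\<exists>B \<in> carrier_mat n n. A * B = 1\<^sub>m n)"

lemma right_invertible_gl_similar:
  assumes A: "right_invertible n A" and w: "gl_similar n A B"
  shows "right_invertible n B"
proof -
  from w obtain P Q c d where w: "B \<in> carrier_mat n n" "gl_word n P c" "gl_word n Q d"
    "P * Q = 1\<^sub>m n" "Q * P = 1\<^sub>m n" "A = P * B * Q" unfolding gl_similar_def by blast
  from A obtain T where T: "A \<in> carrier_mat n n" "T \<in> carrier_mat n n" "A * T = 1\<^sub>m n" unfolding right_invertible_def by blast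
  note cr = w(1) w(2,3) [THEN gl_word_carrier] T(1,2)
  have "B * (Q * T * P) = (Q * P) * (B * (Q * T * P))" using cr w by (simp add: mult_carrier_mat [of _ n n])
  also have "\<dots> = Q * ((A * T) * P)" using cr by (simp add: w(6) sq_assoc [where n = n])
  also have "\<dots> = 1\<^sub>m n" using cr w T by simp
  finally show ?thesis unfolding right_invertible_def using cr by (intro conjI bexI [of _ "Q * T * P"]) (auto simp: mult_carrier_mat [of _ n n])
qed

text \<open>
  A right inverse of \<open>B - C R\<close> is the lower right block of a right inverse of the whole matrix.
\<close>

lemma right_invertible_schur:
  fixes B :: "'a::division_ring mat"
  assumes c: "R \<in> carrier_mat 1 m" "C \<in> carrier_mat m 1" "B \<in> carrier_mat m m"
    and A: "right_invertible (Suc m) (four_block_mat (1\<^sub>m 1) R C B)"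
  shows "right_invertible m (B - C * R)"
proof -
  from A obtain T where T: "T \<in> carrier_mat (Suc m) (Suc m)" "four_block_mat (1\<^sub>m 1) R C B * T = 1\<^sub>m (Suc m)"
    unfolding right_invertible_def by blast
  from T(1) obtain a R' C' B' where T': "T = four_block_mat (mat 1 1 (\<lambda>_. a)) R' C' B'"
    "R' \<in> carrier_mat 1 m" "C' \<in> carrier_mat m 1" "B' \<in> carrier_mat m m"
    by (rule split_first_row_col) blast
  let ?a = "mat 1 1 (\<lambda>_. a) :: 'a mat"
  have eq: "four_block_mat (1\<^sub>m 1 * ?a + R * C') (1\<^sub>m 1 * R' + R * B') (C * ?a + B * C') (C * R' + B * B') =
    four_block_mat (1\<^sub>m 1) (0\<^sub>m 1 m) (0\<^sub>m m 1) (1\<^sub>m m)"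
    using T(2) c T'(2-) unfolding one_block_one T'(1)
    by (subst (asm) mult_four_block_mat [of _ 1 1 _ m _ m _ _ 1 _ m]) (auto simp del: One_nat_def)
  have 1: "1\<^sub>m 1 * R' + R * B' = 0\<^sub>m 1 m" and 2: "C * R' + B * B' = 1\<^sub>m m"
    by (rule four_block_inject [OF eq, of 1 1 m m]; use c T' in simp)+
  have R': "R' = - (R * B')"
  proof (rule eq_matI)
    fix i j assume "i < dim_row (- (R * B'))" "j < dim_col (- (R * B'))"
    then have ij: "i < 1" "j < m" using c T' by auto
    then have "(1\<^sub>m 1 * R' + R * B') $$ (i,j) = 0" unfolding 1 by simp
    then show "R' $$ (i,j) = (- (R * B')) $$ (i,j)" using ij c T'
      by (simp add: eq_neg_iff_add_eq_0 left_mult_one_mat [of _ 1 m] del: One_nat_def)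
  qed (use c T' in auto)
  have "(B - C * R) * B' = B * B' - C * (R * B')"
    using c T' by (simp add: minus_mult_distrib_mat [of _ m m] assoc_mult_mat [of _ m 1 _ m _ m] del: One_nat_def)
  also have "\<dots> = C * R' + B * B'"
    unfolding R' using c T' by (intro eq_matI) auto
  finally show ?thesis unfolding right_invertible_def 2 using c T' by (intro conjI bexI [of _ B']) auto
qed

lemma addrow_mat_conj:
  fixes A :: "'a::ring_1 mat"
  assumes A: "A \<in> carrier_mat n n" and kl: "k < n" "l < n" "k \<noteq> l"
  shows "addrow_mat n x k l * A * addrow_mat n (- x) k l = mat n n (\<lambda>(i,j).
    let r = (\<lambda>j. if i = k then x * A $$ (l,j) + A $$ (i,j) else A $$ (i,j))
    in if j = l then r l - r k * x else r j)"
  unfolding addrow_mat [OF A kl(2), symmetric]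
  using A kl by (subst mult_addrow_mat) (auto simp: Let_def intro!: eq_matI)

lemma gl_similar_addrow:
  fixes A :: "'a::division_ring mat"
  assumes "A \<in> carrier_mat n n" "k < l" "l < n"
  shows "gl_similar n A (addrow_mat n x k l * A * addrow_mat n (- x) k l)"
  using assms by (intro gl_similar_unitri upper_unitriangular_addrow_mat addrow_mat_inverse) auto

text \<open>
  If no conjugate by a transvection has a nonzero entry off the diagonal, then \<open>A\<close> is diagonal and
  \<open>A (k, k) * x = x * A (l, l)\<close> for all \<open>x\<close> and all \<open>k < l\<close>, which means that \<open>A\<close> is a central scalar.
\<close>

lemma gl_similar_off_diagonal:
  fixes A :: "'a::division_ring mat"
  assumes A: "A \<in> carrier_mat n n" and n: "2 \<le> n" and nc: "\<not> central_scalar n A"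
  shows "\<exists>A' i j. gl_similar n A A' \<and> A' \<in> carrier_mat n n \<and> i < n \<and> j < n \<and> i \<noteq> j \<and> A' $$ (i,j) \<noteq> 0"
proof (rule ccontr)
  assume "\<not> ?thesis"
  then have H: "A' $$ (i,j) = 0" if "gl_similar n A A'" "A' \<in> carrier_mat n n" "i < n" "j < n" "i \<noteq> j" for A' i j
    using that by blast
  have diag: "A $$ (i,j) = 0" if "i < n" "j < n" "i \<noteq> j" for i j
    using H [OF gl_similar_refl [OF A] A] that by blast
  have comm: "A $$ (k,k) * x = x * A $$ (l,l)" if kl: "k < l" "l < n" for k l x
  proof -
    have "(addrow_mat n x k l * A * addrow_mat n (- x) k l) $$ (k,l) = 0"
      using kl A by (intro H gl_similar_addrow) (auto simp: mult_carrier_mat [of _ n n])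
    then show ?thesis
      using kl A diag by (simp add: addrow_mat_conj [OF A])
  qed
  show False
  proof -
    from n have n2: "1 < n" by simp
    define a where "a = A $$ (0,0)"
    have aa: "A $$ (i,i) = a" if "i < n" for i
      using comm [of 0 i 1] that by (cases "i = 0") (auto simp: a_def)
    have "a * x = x * a" for x
      using comm [of 0 1 x] n2 aa [of 0] aa [of 1] by simp
    moreover have "A = monomial_mat n id (\<lambda>_. a)"
      using A diag aa by (auto simp: monomial_mat_def intro!: eq_matI)
    ultimately show False using nc by (auto simp: central_scalar_def)
  qed
qed

text \<open>
  A swap moves the nonzero entry off the diagonal into the first column, and a transvection that adds
  a multiple of its row to the first row then produces the pivot \<open>1\<close>.
\<close>

lemma gl_similar_pivot:
  fixes A :: "'a::division_ring mat"
  assumes A: "A \<in> carrier_mat n n" and n: "2 \<le> n" and nc: "\<not> central_scalar n A"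
  shows "\<exists>A' i. gl_similar n A A' \<and> A' \<in> carrier_mat n n \<and> A' $$ (0,0) = 1 \<and> 0 < i \<and> i < n \<and> A' $$ (i,0) \<noteq> 0"
proof -
  from gl_similar_off_diagonal [OF A n nc] obtain B r s where B: "gl_similar n A B" "B \<in> carrier_mat n n"
    "r < n" "s < n" "r \<noteq> s" "B $$ (r,s) \<noteq> 0" by blast
  have n0: "0 < n" using n by simp
  let ?S = "swaprows_mat n 0 s :: 'a mat"
  define C where "C = ?S * B * ?S"
  define i where "i = transpose 0 s r"
  have C: "C = mat n n (\<lambda>(i,j). B $$ (transpose 0 s i, transpose 0 s j))"
    unfolding C_def by (rule swaprows_mat_conj [OF B(2) n0 B(4)])
  have i: "0 < i" "i < n" using B(3,4,5) n0 by (auto simp: i_def transpose_def)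
  have Ci: "C $$ (i,0) \<noteq> 0" using B(6) i n0 by (simp add: C i_def)
  have Cc: "C \<in> carrier_mat n n" by (simp add: C)
  have BC: "gl_similar n B C"
    unfolding C_def using gl_word_swap_first [OF B(4)] swaprows_mat_inv [OF n0 B(4)] B(2)
    by (metis gl_similar_conj)
  define z where "z = (1 - C $$ (0,0)) * inverse (C $$ (i,0))"
  define D where "D = addrow_mat n z 0 i * C * addrow_mat n (- z) 0 i"
  have D: "D = mat n n (\<lambda>(r,j).
    let w = (\<lambda>j. if r = 0 then z * C $$ (i,j) + C $$ (r,j) else C $$ (r,j))
    in if j = i then w i - w 0 * z else w j)"
    unfolding D_def by (rule addrow_mat_conj [OF Cc n0 i(2)]) (use i in simp)
  have "D $$ (0,0) = 1" "D $$ (i,0) \<noteq> 0"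
    using i n0 Ci by (simp_all add: D z_def mult.assoc)
  moreover have "gl_similar n A D"
    unfolding D_def using gl_similar_trans [OF gl_similar_trans [OF B(1) BC] gl_similar_addrow [OF Cc i]] .
  moreover have "D \<in> carrier_mat n n" by (simp add: D)
  ultimately show ?thesis using i by blast
qed

lemma central_scalar_off_diagonal:
  assumes "central_scalar m S"
  shows "\<exists>a. \<forall>i<m. \<forall>j<m. S $$ (i,j) = (if i = j then a else 0)"
proof -
  from assms obtain a where "S = monomial_mat m id (\<lambda>_. a)" by (auto simp: central_scalar_def)
  then show ?thesis by (intro exI [of _ a]) (auto simp: monomial_mat_def)
qed

text \<open>
  The elimination can only be continued if the Schur complement is not a central scalar. If it is
  \<open>S = a * 1\<close>, take a nonzero row \<open>y\<close> with \<open>y C = 0\<close> and conjugate by \<open>[1, y; 0, 1]\<close>. The pivot stays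
  \<open>1\<close> and the complement becomes \<open>S - C (y B)\<close>. Its difference from \<open>S\<close> has rank at most one, so it is
  again a scalar only if \<open>y B = 0\<close>; but then \<open>(0, y)\<close> annihilates an invertible matrix.
\<close>

lemma gl_similar_schur_noncentral:
  fixes B :: "'a::division_ring mat"
  assumes c: "R \<in> carrier_mat 1 m" "C \<in> carrier_mat m 1" "B \<in> carrier_mat m m"
    and A: "right_invertible (Suc m) (four_block_mat (1\<^sub>m 1) R C B)"
    and i: "i < m" "C $$ (i,0) \<noteq> 0" and m: "2 \<le> m"
  shows "\<exists>R' B'. R' \<in> carrier_mat 1 m \<and> B' \<in> carrier_mat m m \<and>
    gl_similar (Suc m) (four_block_mat (1\<^sub>m 1) R C B) (four_block_mat (1\<^sub>m 1) R' C B') \<and>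
    \<not> central_scalar m (B' - C * R')"
proof (cases "central_scalar m (B - C * R)")
  case False
  then show ?thesis using c gl_similar_refl [OF four_block_Suc_carrier [OF one_carrier_mat c(3)]] by blast
next
  case True
  let ?A = "four_block_mat (1\<^sub>m 1) R C B"
  have Ac: "?A \<in> carrier_mat (Suc m) (Suc m)" by (rule four_block_Suc_carrier [OF one_carrier_mat c(3)])
  have "\<exists>j<m. j \<noteq> i" using m by (intro exI [of _ "if i = 0 then 1 else 0"]) auto
  then obtain j where j: "j < m" "j \<noteq> i" by blast
  define y where "y = mat 1 m (\<lambda>(_,t). if t = j then 1 else if t = i then - (C $$ (j,0) * inverse (C $$ (i,0))) else 0)"
  have y: "y \<in> carrier_mat 1 m" by (simp add: y_def)
  have yC: "y * C = 0\<^sub>m 1 1"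
  proof (rule eq_matI)
    fix r s assume "r < dim_row (0\<^sub>m 1 1 :: 'a mat)" "s < dim_col (0\<^sub>m 1 1 :: 'a mat)"
    then have rs: "r = 0" "s = 0" by auto
    have "(y * C) $$ (0,0) = (\<Sum>t\<in>{0..<m}. y $$ (0,t) * C $$ (t,0))"
      using c y by (simp add: scalar_prod_def)
    also have "\<dots> = (\<Sum>t\<in>{0..<m}. (if t = j then C $$ (j,0) else 0) + (if t = i then - C $$ (j,0) else 0))"
      using i j by (intro sum.cong) (auto simp: y_def mult.assoc)
    also have "\<dots> = 0" using i j by (simp add: sum.distrib)
    finally show "(y * C) $$ (r,s) = 0\<^sub>m 1 1 $$ (r,s)" using rs by simp
  qed (use c y in auto)
  define z where "z = y * B"
  have z: "z \<in> carrier_mat 1 m" using y c by (simp add: z_def)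
  let ?R = "(R + z) - y" and ?B = "B - C * y"
  have R': "?R \<in> carrier_mat 1 m" and B': "?B \<in> carrier_mat m m" using c y z by (auto simp: minus_carrier_mat)
  let ?U = "four_block_mat (1\<^sub>m 1) y (0\<^sub>m m 1) (1\<^sub>m m)" and ?V = "four_block_mat (1\<^sub>m 1) (- y) (0\<^sub>m m 1) (1\<^sub>m m)"
  have U: "upper_unitriangular (Suc m) ?U" "upper_unitriangular (Suc m) ?V"
    by (rule upper_unitriangular_four_block [OF _ upper_unitriangular_one]; use y in simp)+
  have yy: "- y + y = 0\<^sub>m 1 m" using y by (auto intro!: eq_matI)
  have UV: "?U * ?V = 1\<^sub>m (Suc m)"
    unfolding one_block_one [symmetric] using y
    by (subst mult_four_block_mat [of _ 1 1 _ m _ m _ _ 1 _ m]) (auto simp: yy simp del: One_nat_def)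
  have UA: "?U * ?A = four_block_mat (1\<^sub>m 1) (R + z) C B"
    using c y
    by (subst mult_four_block_mat [of _ 1 1 _ m _ m _ _ 1 _ m])
      (auto simp: yC z_def left_mult_zero_mat [of _ 1 m] left_mult_zero_mat [of _ 1 1] simp del: One_nat_def)
  have "four_block_mat (1\<^sub>m 1) (R + z) C B * ?V = four_block_mat (1\<^sub>m 1) ?R C ?B"
  proof -
    have e: "1\<^sub>m 1 * (- y) + (R + z) * 1\<^sub>m m = ?R" "C * (- y) + B * 1\<^sub>m m = ?B"
      "1\<^sub>m 1 * 1\<^sub>m 1 + (R + z) * 0\<^sub>m m 1 = 1\<^sub>m 1" "C * 1\<^sub>m 1 + B * 0\<^sub>m m 1 = C"
      using c y z by (auto intro!: eq_matI simp: left_mult_one_mat [of _ 1 m] right_mult_one_mat [of _ 1 m]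
          right_mult_one_mat [of _ m 1] right_mult_one_mat [of _ m m] simp del: One_nat_def)
    show ?thesis using c y z
      by (subst mult_four_block_mat [of _ 1 1 _ m _ m _ _ 1 _ m]) (auto simp: e simp del: One_nat_def)
  qed
  then have "gl_similar (Suc m) ?A (four_block_mat (1\<^sub>m 1) ?R C ?B)"
    using gl_similar_unitri [OF U UV Ac] UA by simp
  moreover have "\<not> central_scalar m (?B - C * ?R)"
  proof
    assume C': "central_scalar m (?B - C * ?R)"
    have Cent: "(C * w) $$ (r,s) = C $$ (r,0) * w $$ (0,s)" if "w \<in> carrier_mat 1 m" "r < m" "s < m" for w r s
      using that c by (simp add: scalar_prod_def)
    from True obtain a where a: "\<And>r s. r < m \<Longrightarrow> s < m \<Longrightarrow> (B - C * R) $$ (r,s) = (if r = s then a else 0)"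
      using central_scalar_off_diagonal by blast
    from C' obtain b where b: "\<And>r s. r < m \<Longrightarrow> s < m \<Longrightarrow> (?B - C * ?R) $$ (r,s) = (if r = s then b else 0)"
      using central_scalar_off_diagonal by blast
    have Cz: "C $$ (r,0) * z $$ (0,s) = (if r = s then a - b else 0)" if rs: "r < m" "s < m" for r s
    proof -
      have e1: "(?B - C * ?R) $$ (r,s) = B $$ (r,s) - C $$ (r,0) * y $$ (0,s)
          - C $$ (r,0) * (R $$ (0,s) + z $$ (0,s) - y $$ (0,s))"
        using rs c y z R' Cent [OF y rs] Cent [OF R' rs] by simp
      have e2: "(B - C * R) $$ (r,s) = B $$ (r,s) - C $$ (r,0) * R $$ (0,s)"
        using rs c Cent [OF c(1) rs] by simp
      have "(B - C * R) $$ (r,s) - (?B - C * ?R) $$ (r,s) = C $$ (r,0) * z $$ (0,s)"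
        unfolding e1 e2 by (simp add: algebra_simps)
      then show ?thesis unfolding a [OF rs] b [OF rs] by auto
    qed
    have zs: "z $$ (0,s) = 0" if "s < m" "s \<noteq> i" for s
      using Cz [OF i(1) that(1)] that i(2) by simp
    then have "a = b" using Cz [OF j(1) j(1)] j by simp
    then have "z $$ (0,i) = 0" using Cz [OF i(1) i(1)] i(2) by simp
    with zs have "z $$ (0,s) = 0" if "s < m" for s using that by (cases "s = i") auto
    then have z0: "z = 0\<^sub>m 1 m" using z by (auto intro!: eq_matI)
    from A obtain T where T: "T \<in> carrier_mat (Suc m) (Suc m)" "?A * T = 1\<^sub>m (Suc m)" unfolding right_invertible_def by blast
    let ?W = "four_block_mat (0\<^sub>m 1 1) y (0\<^sub>m m 1) (0\<^sub>m m m)"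
    have Wc: "?W \<in> carrier_mat (Suc m) (Suc m)" by (rule four_block_Suc_carrier) auto
    have "?W * ?A = four_block_mat (0\<^sub>m 1 1) (0\<^sub>m 1 m) (0\<^sub>m m 1) (0\<^sub>m m m)"
      using c y z0 by (subst mult_four_block_mat [of _ 1 1 _ m _ m _ _ 1 _ m])
        (auto simp: yC z_def left_mult_zero_mat [of _ 1 m] left_mult_zero_mat [of _ m 1] left_mult_zero_mat [of _ m m] simp del: One_nat_def)
    also have "\<dots> = 0\<^sub>m (Suc m) (Suc m)" by (auto intro!: eq_matI)
    finally have WA: "?W * ?A = 0\<^sub>m (Suc m) (Suc m)" .
    have "?W = ?W * (?A * T)" using Wc T by simp
    also have "\<dots> = (?W * ?A) * T" using Wc Ac T(1) by (simp add: assoc_mult_mat [of _ "Suc m" "Suc m" _ "Suc m" _ "Suc m"])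
    also have "\<dots> = 0\<^sub>m (Suc m) (Suc m)" unfolding WA using T(1) by simp
    finally have "?W $$ (0, Suc j) = 0\<^sub>m (Suc m) (Suc m) $$ (0, Suc j)" by simp
    then show False using j y by (simp add: y_def)
  qed
  ultimately show ?thesis using R' B' by blast
qed

definition diag_last :: "nat \<Rightarrow> 'a::division_ring \<Rightarrow> 'a mat" where
  "diag_last m d = monomial_mat m id (\<lambda>i. if Suc i = m then d else 1)"

lemma diag_last_carrier [simp]: "diag_last m d \<in> carrier_mat m m"
  by (simp add: diag_last_def)

lemma diag_last_one: "diag_last m 1 = 1\<^sub>m m"
  by (auto simp: diag_last_def monomial_mat_def intro!: eq_matI)

lemma diag_last_mult: "diag_last m c * diag_last m d = diag_last m (c * d)"
  unfolding diag_last_def by (subst monomial_mat_diag_mult) (auto intro!: arg_cong [where f = "monomial_mat m id"])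

lemma one_block_diag_last: "0 < m \<Longrightarrow> one_block m (diag_last m d) = diag_last (Suc m) d"
  by (rule eq_matI) (auto simp: diag_last_def monomial_mat_def)

lemma prod_list_diag_last:
  assumes "0 < m"
  shows "prod_list (map (\<lambda>i. if Suc i = m then d else 1) [0..<m]) = (d :: 'a::division_ring)"
proof -
  from assms obtain k where m: "m = Suc k" by (cases m) auto
  have "prod_list (map (\<lambda>i. if Suc i = m then d else 1) xs) = 1" if "k \<notin> set xs" for xs
    using that by (induction xs) (auto simp: m)
  then show ?thesis by (simp add: m)
qed

lemma gl_word_diag_last: "0 < m \<Longrightarrow> d \<noteq> 0 \<Longrightarrow> gl_word m (diag_last m d) d"
  using gl_word_diag [of m "\<lambda>i. if Suc i = m then d else 1"]
  by (simp add: diag_last_def prod_list_diag_last)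

text \<open>
  Induction on the size. With pivot \<open>1\<close> the matrix is \<open>[1, R; C, C R + S]\<close>, and if
  \<open>S = P (X D Y) Q\<close> with \<open>P Q = 1\<close>, then conjugation by \<open>diag (1, P)\<close> turns it into
  \<open>[1, 0; Q C, X] diag (1, D) [1, R P; 0, Y]\<close>. The case \<open>m = 1\<close> is the last pivot, which
  becomes \<open>d\<close> whatever it is.
\<close>

lemma noncentral_LDU:
  fixes A :: "'a::division_ring mat"
  assumes "0 < m" "right_invertible m A" "m = 1 \<or> \<not> central_scalar m A"
  shows "\<exists>X Y d. unipotent_mat m X \<and> unipotent_mat m Y \<and> gl_word m X 1 \<and> gl_word m Y 1 \<and> d \<noteq> 0 \<and>
    gl_similar m A (X * diag_last m d * Y)"
  using assms
proof (induction m arbitrary: A)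
  case 0
  then show ?case by simp
next
  case (Suc m)
  note Ac = Suc.prems(2) [unfolded right_invertible_def, THEN conjunct1]
  show ?case
  proof (cases "m = 0")
    case True
    define d where "d = A $$ (0,0)"
    have Ad: "A = diag_last (Suc m) d"
      using Ac True by (auto simp: diag_last_def monomial_mat_def d_def intro!: eq_matI)
    from Suc.prems(2) obtain T where T: "T \<in> carrier_mat 1 1" "A * T = 1\<^sub>m 1"
      unfolding right_invertible_def using True by auto
    have "(A * T) $$ (0,0) = d * T $$ (0,0)"
      using Ac T(1) True by (simp add: scalar_prod_def d_def)
    moreover have "(A * T) $$ (0,0) = 1" unfolding T(2) by simp
    ultimately have "d \<noteq> 0" by auto
    then show ?thesis
      using unipotent_one [of "Suc m"] gl_word.one [of "Suc m"] gl_similar_refl [OF Ac] Ac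
      by (intro exI [of _ "1\<^sub>m (Suc m)"] exI [of _ d]) (auto simp flip: Ad)
  next
    case False
    then have nc: "\<not> central_scalar (Suc m) A" and m2: "2 \<le> Suc m" using Suc.prems(3) by auto
    from gl_similar_pivot [OF Ac m2 nc] obtain A' i where A': "gl_similar (Suc m) A A'" "A' \<in> carrier_mat (Suc m) (Suc m)"
      "A' $$ (0,0) = 1" "0 < i" "i < Suc m" "A' $$ (i,0) \<noteq> 0" by blast
    from A'(2) obtain a R C B where RCB: "A' = four_block_mat (mat 1 1 (\<lambda>_. a)) R C B" "a = A' $$ (0,0)"
      "R \<in> carrier_mat 1 m" "C \<in> carrier_mat m 1" "B \<in> carrier_mat m m"
      "\<And>i. i < m \<Longrightarrow> C $$ (i,0) = A' $$ (Suc i,0)"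
      by (rule split_first_row_col) blast
    have "mat 1 1 (\<lambda>_. a) = 1\<^sub>m 1" using RCB(2) A'(3) by (auto intro!: eq_matI)
    with RCB(1) have A'eq: "A' = four_block_mat (1\<^sub>m 1) R C B" by simp
    from A'(4,5,6) RCB(6) [of "i - 1"] have Ci: "i - 1 < m" "C $$ (i - 1, 0) \<noteq> 0" by auto
    have rA': "right_invertible (Suc m) (four_block_mat (1\<^sub>m 1) R C B)"
      using right_invertible_gl_similar [OF Suc.prems(2) A'(1)] A'eq by simp
    have "\<exists>R' B'. R' \<in> carrier_mat 1 m \<and> B' \<in> carrier_mat m m \<and>
      gl_similar (Suc m) A' (four_block_mat (1\<^sub>m 1) R' C B') \<and> (m = 1 \<or> \<not> central_scalar m (B' - C * R'))"
    proof (cases "m = 1")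
      case True
      then show ?thesis using RCB(3,5) gl_similar_refl [OF A'(2)] A'eq by (intro exI [of _ R] exI [of _ B]) auto
    next
      case m1: False
      with False have "2 \<le> m" by simp
      from gl_similar_schur_noncentral [OF RCB(3,4,5) rA' Ci this] show ?thesis unfolding A'eq by blast
    qed
    then obtain R' B' where R': "R' \<in> carrier_mat 1 m" and B': "B' \<in> carrier_mat m m"
      and w: "gl_similar (Suc m) A' (four_block_mat (1\<^sub>m 1) R' C B')"
      and ns: "m = 1 \<or> \<not> central_scalar m (B' - C * R')" by blast
    let ?S = "B' - C * R'"
    have rS: "right_invertible m ?S"
      using right_invertible_schur [OF R' RCB(4) B' right_invertible_gl_similar [OF right_invertible_gl_similar [OF Suc.prems(2) A'(1)] w]] .
    have "0 < m" using False by simp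
    from Suc.IH [OF this rS ns] obtain X Y d where IH: "unipotent_mat m X" "unipotent_mat m Y"
      "gl_word m X 1" "gl_word m Y 1" "d \<noteq> 0" "gl_similar m ?S (X * diag_last m d * Y)" by blast
    let ?D = "diag_last m d"
    from IH(6) obtain P Q p q where PQ: "gl_word m P p" "gl_word m Q q" "P * Q = 1\<^sub>m m" "Q * P = 1\<^sub>m m"
      "?S = P * (X * ?D * Y) * Q" unfolding gl_similar_def by blast
    note cr = IH(3,4) [THEN gl_word_carrier] PQ(1,2) [THEN gl_word_carrier] RCB(4) R' B'
    let ?QC = "Q * C" and ?RP = "R' * P"
    have QC: "?QC \<in> carrier_mat m 1" and RP: "?RP \<in> carrier_mat 1 m" using cr by auto
    let ?X = "four_block_mat (1\<^sub>m 1) (0\<^sub>m 1 m) ?QC X" and ?Y = "four_block_mat (1\<^sub>m 1) ?RP (0\<^sub>m m 1) Y"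
    note mb = mult_four_block_mat [of _ 1 1 _ m _ m _ _ 1 _ m]
    have XD: "X * ?D \<in> carrier_mat m m" and XDY: "X * ?D * Y \<in> carrier_mat m m"
      using cr by (auto simp: mult_carrier_mat [of _ m m])
    have z1: "0\<^sub>m 1 m * Z = 0\<^sub>m 1 m" if "Z \<in> carrier_mat m m" for Z :: "'a mat"
      using that by simp
    have z2: "0\<^sub>m m 1 * Z = 0\<^sub>m m m" if "Z \<in> carrier_mat 1 m" for Z :: "'a mat"
      using that by simp
    have z3: "0\<^sub>m 1 m * Z = 0\<^sub>m 1 1" if "Z \<in> carrier_mat m 1" for Z :: "'a mat"
      using that by simp
    note zz = z1 z2 z3
    have left: "one_block m Z * four_block_mat (1\<^sub>m 1) U V W = four_block_mat (1\<^sub>m 1) U (Z * V) (Z * W)"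
      if "Z \<in> carrier_mat m m" "U \<in> carrier_mat 1 m" "V \<in> carrier_mat m 1" "W \<in> carrier_mat m m" for Z U V W :: "'a mat"
      using that zz by (subst mb) (auto simp: left_mult_one_mat [of _ 1 m] right_mult_one_mat [of _ m 1] simp del: One_nat_def)
    have right: "four_block_mat (1\<^sub>m 1) U V W * one_block m Z = four_block_mat (1\<^sub>m 1) (U * Z) V (W * Z)"
      if "Z \<in> carrier_mat m m" "U \<in> carrier_mat 1 m" "V \<in> carrier_mat m 1" "W \<in> carrier_mat m m" for Z U V W :: "'a mat"
      using that zz by (subst mb) (auto simp: left_mult_one_mat [of _ 1 m] right_mult_one_mat [of _ m 1] simp del: One_nat_def)
    have lu: "four_block_mat (1\<^sub>m 1) (0\<^sub>m 1 m) V W * four_block_mat (1\<^sub>m 1) U (0\<^sub>m m 1) Z =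
        four_block_mat (1\<^sub>m 1) U V (V * U + W * Z)"
      if "Z \<in> carrier_mat m m" "U \<in> carrier_mat 1 m" "V \<in> carrier_mat m 1" "W \<in> carrier_mat m m" for Z U V W :: "'a mat"
      using that zz by (subst mb) (auto simp: left_mult_one_mat [of _ 1 m] right_mult_one_mat [of _ m 1] simp del: One_nat_def)
    have "?X = four_block_mat (1\<^sub>m 1) (0\<^sub>m 1 m) ?QC (1\<^sub>m m) * one_block m X"
      using right [OF cr(1) _ QC, of "0\<^sub>m 1 m" "1\<^sub>m m"] cr zz by (simp del: One_nat_def)
    then have gX: "gl_word (Suc m) ?X 1"
      using gl_word_mult [OF gl_word_first_column [OF QC] gl_word_one_block [OF IH(3)]] by simp
    have "?Y = one_block m Y * four_block_mat (1\<^sub>m 1) ?RP (0\<^sub>m m 1) (1\<^sub>m m)"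
      using left [OF cr(2) RP, of "0\<^sub>m m 1" "1\<^sub>m m"] cr by (simp add: right_mult_zero_mat [of _ m m] del: One_nat_def)
    then have gY: "gl_word (Suc m) ?Y 1"
      using gl_word_mult [OF gl_word_one_block [OF IH(4)]
        gl_word_unitri [OF upper_unitriangular_four_block [OF RP upper_unitriangular_one]]] by simp
    have XDY': "?X * diag_last (Suc m) d * ?Y = four_block_mat (1\<^sub>m 1) ?RP ?QC (?QC * ?RP + X * ?D * Y)"
      unfolding one_block_diag_last [OF \<open>0 < m\<close>, symmetric]
      using right [OF diag_last_carrier _ QC cr(1), of "0\<^sub>m 1 m" d] lu [OF cr(2) RP QC XD] zz
      by (simp del: One_nat_def)
    have sum: "?QC * ?RP + X * ?D * Y \<in> carrier_mat m m" using QC RP XDY by auto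
    have 1: "?RP * Q = R'" "P * ?QC = C"
      using cr PQ(3) by (simp_all add: assoc_mult_mat [of _ 1 m _ m _ m] right_mult_one_mat [of _ 1 m]
          left_mult_one_mat [of _ m 1] flip: assoc_mult_mat [of P m m Q m C 1] del: One_nat_def)
    have dist: "P * (S + T) * Q = P * S * Q + P * T * Q"
      if "S \<in> carrier_mat m m" "T \<in> carrier_mat m m" for S T
      using that cr by (simp add: mult_add_distrib_mat [of _ m m] add_mult_distrib_mat [of _ m m] mult_carrier_mat [of _ m m])
    have "P * (?QC * ?RP + X * ?D * Y) * Q = P * (?QC * ?RP) * Q + P * (X * ?D * Y) * Q"
      by (rule dist [OF mult_carrier_mat [OF QC RP] XDY])
    also have "P * (?QC * ?RP) * Q = (P * ?QC) * (?RP * Q)"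
      using assoc_mult_mat [OF cr(3) QC RP] assoc_mult_mat [OF mult_carrier_mat [OF cr(3) QC] RP cr(4)] by simp
    finally have 2: "P * (?QC * ?RP + X * ?D * Y) * Q = C * R' + ?S" unfolding 1 PQ(5) .
    have 3: "C * R' + ?S = B'" using cr by (auto intro!: eq_matI)
    have "four_block_mat (1\<^sub>m 1) R' C B' =
      one_block m P * (?X * diag_last (Suc m) d * ?Y) * one_block m Q"
      unfolding XDY' left [OF cr(3) RP QC sum]
      by (subst right [OF cr(4) RP]) (use cr QC sum 1 2 3 in \<open>auto simp: mult_carrier_mat [of _ m m] simp del: One_nat_def\<close>)
    moreover have "?X * diag_last (Suc m) d * ?Y \<in> carrier_mat (Suc m) (Suc m)"
      unfolding XDY' by (rule four_block_Suc_carrier [OF one_carrier_mat sum])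
    moreover have "one_block m P * one_block m Q = 1\<^sub>m (Suc m)" "one_block m Q * one_block m P = 1\<^sub>m (Suc m)"
      using one_block_mult [OF cr(3,4)] one_block_mult [OF cr(4,3)] unfolding PQ(3,4) one_block_one by simp_all
    ultimately have "gl_similar (Suc m) (four_block_mat (1\<^sub>m 1) R' C B') (?X * diag_last (Suc m) d * ?Y)"
      using gl_similarI gl_word_one_block [OF PQ(1)] gl_word_one_block [OF PQ(2)] by blast
    from gl_similar_trans [OF A'(1) gl_similar_trans [OF w this]] gX gY IH(5)
      unipotent_lower_block [OF QC IH(1)] unipotent_upper_block [OF RP IH(2)]
    show ?thesis by blast
  qed
qed

section \<open>The centre of a division ring\<close>

text \<open>
  The centre is made a type, so that the results on matrices over division rings can be applied to it
  as a field, where the derived subgroup is trivial.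
\<close>

typedef (overloaded) 'a center = "{x :: 'a::division_ring. \<forall>y. x * y = y * x}"
  by (rule exI [of _ 0]) simp

setup_lifting type_definition_center

instantiation center :: (division_ring) field
begin

lift_definition zero_center :: "'a center" is 0 by simp
lift_definition one_center :: "'a center" is 1 by simp
lift_definition plus_center :: "'a center \<Rightarrow> 'a center \<Rightarrow> 'a center" is "(+)"
  by (simp add: distrib_left distrib_right)
lift_definition minus_center :: "'a center \<Rightarrow> 'a center \<Rightarrow> 'a center" is "(-)"
  by (simp add: left_diff_distrib right_diff_distrib)
lift_definition uminus_center :: "'a center \<Rightarrow> 'a center" is uminus by simp
lift_definition times_center :: "'a center \<Rightarrow> 'a center \<Rightarrow> 'a center" is "(*)"
  by (metis mult.assoc)
lift_definition inverse_center :: "'a center \<Rightarrow> 'a center" is inverse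
  by (metis inverse_zero mult_commute_imp_mult_inverse_commute mult_zero_left mult_zero_right)
definition divide_center :: "'a center \<Rightarrow> 'a center \<Rightarrow> 'a center" where
  "divide_center x y = x * inverse y"

instance
proof
  fix a b c :: "'a center"
  show "a + b + c = a + (b + c)" by transfer (rule add.assoc)
  show "a + b = b + a" by transfer (rule add.commute)
  show "0 + a = a" by transfer (rule add_0)
  show "- a + a = 0" by transfer (rule left_minus)
  show "a - b = a + - b" by transfer (rule diff_conv_add_uminus)
  show "a * b * c = a * (b * c)" by transfer (rule mult.assoc)
  show "a * b = b * a" by transfer blast
  show "1 * a = a" by transfer (rule mult_1)
  show "(a + b) * c = a * c + b * c" by transfer (rule distrib_right)
  show "(0 :: 'a center) \<noteq> 1" by transfer (rule zero_neq_one)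
  show "a \<noteq> 0 \<Longrightarrow> inverse a * a = 1" by transfer (rule left_inverse)
  show "a div b = a * inverse b" by (rule divide_center_def)
  show "inverse (0 :: 'a center) = 0" by transfer (rule inverse_zero)
qed

end

interpretation center: semiring_hom "Rep_center :: 'a::division_ring center \<Rightarrow> 'a"
  by standard (simp_all add: zero_center.rep_eq one_center.rep_eq plus_center.rep_eq times_center.rep_eq)

lemma Rep_center_power: "Rep_center (a ^ k) = Rep_center a ^ k"
  by (induction k) (simp_all add: center.hom_one center.hom_mult)

lemma Rep_center_inverse: "Rep_center (inverse a) = inverse (Rep_center a)"
  by (rule inverse_center.rep_eq)

section \<open>Products of unipotent matrices\<close>

definition unipotent_product :: "nat \<Rightarrow> nat \<Rightarrow> 'a::division_ring mat \<Rightarrow> bool" where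
  "unipotent_product n k A \<longleftrightarrow> (\<exists>us. length us \<le> k \<and> (\<forall>u \<in> set us. unipotent_mat n u) \<and> A = foldr (*) us (1\<^sub>m n))"

lemma foldr_mat_carrier:
  "(\<And>u. u \<in> set us \<Longrightarrow> u \<in> carrier_mat n n) \<Longrightarrow> foldr (*) us (1\<^sub>m n) \<in> carrier_mat n n"
  by (induction us) (auto simp: mult_carrier_mat [of _ n n])

lemma unipotent_carrier: "unipotent_mat n u \<Longrightarrow> u \<in> carrier_mat n n"
  by (simp add: unipotent_mat_def)

lemma foldr_mat_append:
  fixes us :: "'a::division_ring mat list"
  assumes "\<And>u. u \<in> set (us @ vs) \<Longrightarrow> u \<in> carrier_mat n n"
  shows "foldr (*) (us @ vs) (1\<^sub>m n) = foldr (*) us (1\<^sub>m n) * foldr (*) vs (1\<^sub>m n)"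
  using assms
proof (induction us)
  case Nil
  then show ?case using foldr_mat_carrier [of vs n] by simp
next
  case (Cons u us)
  then have "u \<in> carrier_mat n n" "foldr (*) us (1\<^sub>m n) \<in> carrier_mat n n" "foldr (*) vs (1\<^sub>m n) \<in> carrier_mat n n"
    by (auto intro!: foldr_mat_carrier)
  with Cons show ?case by (simp add: assoc_mult_mat [of _ n n _ n _ n])
qed

lemma unipotent_product_mono: "unipotent_product n k A \<Longrightarrow> k \<le> l \<Longrightarrow> unipotent_product n l A"
  unfolding unipotent_product_def using le_trans by blast

lemma unipotent_product_mult: "unipotent_product n k A \<Longrightarrow> unipotent_product n l B \<Longrightarrow> unipotent_product n (k + l) (A * B)"
proof -
  assume "unipotent_product n k A" "unipotent_product n l B"
  then obtain us vs where *: "length us \<le> k" "\<forall>u \<in> set us. unipotent_mat n u" "A = foldr (*) us (1\<^sub>m n)"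
    "length vs \<le> l" "\<forall>u \<in> set vs. unipotent_mat n u" "B = foldr (*) vs (1\<^sub>m n)"
    unfolding unipotent_product_def by blast
  then have "A * B = foldr (*) (us @ vs) (1\<^sub>m n)"
    by (subst foldr_mat_append) (auto dest: unipotent_carrier)
  with * show "unipotent_product n (k + l) (A * B)"
    unfolding unipotent_product_def by (intro exI [of _ "us @ vs"]) auto
qed

lemma unipotent_product_one: "unipotent_product n 0 (1\<^sub>m n)"
  unfolding unipotent_product_def by (intro exI [of _ "[]"]) auto

lemma unipotent_product_unipotent: "unipotent_mat n A \<Longrightarrow> unipotent_product n 1 A"
  unfolding unipotent_product_def by (intro exI [of _ "[A]"]) (auto dest: unipotent_carrier)

lemma unipotent_conj:
  fixes P :: "'a::division_ring mat"
  assumes c: "P \<in> carrier_mat n n" "Q \<in> carrier_mat n n" and PQ: "P * Q = 1\<^sub>m n" "Q * P = 1\<^sub>m n"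
    and u: "unipotent_mat n u"
  shows "unipotent_mat n (P * u * Q)"
proof -
  from u obtain m where uc: "u \<in> carrier_mat n n" and m: "(1\<^sub>m n - u) ^\<^sub>m m = 0\<^sub>m n n"
    unfolding unipotent_mat_def by blast
  let ?N = "1\<^sub>m n - u"
  have Nc: "?N \<in> carrier_mat n n" by (rule minus_carrier_mat [OF uc])
  have Nk: "?N ^\<^sub>m j \<in> carrier_mat n n" for j using Nc by (rule pow_carrier_mat)
  have "P * ?N = P - P * u"
    using c(1) mult_minus_distrib_mat [OF c(1) one_carrier_mat uc] by simp
  then have N: "1\<^sub>m n - P * u * Q = P * ?N * Q"
    using c uc PQ minus_mult_distrib_mat [OF c(1) mult_carrier_mat [OF c(1) uc] c(2)] by simp
  have "(P * ?N * Q) ^\<^sub>m j = P * ?N ^\<^sub>m j * Q" for j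
  proof (induction j)
    case 0
    then show ?case using c PQ uc by simp
  next
    case (Suc j)
    have "(P * ?N * Q) ^\<^sub>m Suc j = (P * ?N ^\<^sub>m j * Q) * (P * ?N * Q)" by (simp add: Suc)
    also have "\<dots> = P * (?N ^\<^sub>m j * ((Q * P) * (?N * Q)))"
      using c Nc Nk [of j] by (simp add: sq_assoc [where n = n])
    also have "\<dots> = P * ?N ^\<^sub>m Suc j * Q"
      using c Nc Nk [of j] unfolding PQ by (simp add: left_mult_one_mat [of _ n n] sq_assoc [where n = n])
    finally show ?case .
  qed
  then have "(1\<^sub>m n - P * u * Q) ^\<^sub>m m = P * 0\<^sub>m n n * Q" unfolding N by (simp add: m)
  also have "\<dots> = 0\<^sub>m n n" using c by simp
  finally show ?thesis unfolding unipotent_mat_def using c uc by (auto simp: mult_carrier_mat [of _ n n])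
qed

lemma unipotent_product_conj:
  fixes P :: "'a::division_ring mat"
  assumes c: "P \<in> carrier_mat n n" "Q \<in> carrier_mat n n" and PQ: "P * Q = 1\<^sub>m n" "Q * P = 1\<^sub>m n"
    and A: "unipotent_product n k A"
  shows "unipotent_product n k (P * A * Q)"
proof -
  from A obtain us where us: "length us \<le> k" "\<forall>u \<in> set us. unipotent_mat n u" "A = foldr (*) us (1\<^sub>m n)"
    unfolding unipotent_product_def by blast
  have "P * foldr (*) us (1\<^sub>m n) * Q = foldr (*) (map (\<lambda>u. P * u * Q) us) (1\<^sub>m n)"
    using us(2)
  proof (induction us)
    case Nil
    then show ?case using c PQ by simp
  next
    case (Cons u us)
    let ?F = "foldr (*) us (1\<^sub>m n)"
    have cr: "u \<in> carrier_mat n n" "?F \<in> carrier_mat n n"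
      using Cons.prems by (auto intro!: foldr_mat_carrier dest: unipotent_carrier)
    have "(P * u * Q) * (P * ?F * Q) = P * (u * ((Q * P) * (?F * Q)))"
      using c cr by (simp add: sq_assoc [where n = n])
    also have "\<dots> = P * (u * ?F) * Q" unfolding PQ using c cr by (simp add: left_mult_one_mat [of _ n n] sq_assoc [where n = n])
    finally show ?case using Cons by simp
  qed
  then show ?thesis unfolding unipotent_product_def us(3)
    using us unipotent_conj [OF c PQ] by (intro exI [of _ "map (\<lambda>u. P * u * Q) us"]) auto
qed

lemma unipotent_product_one_block:
  fixes A :: "'a::division_ring mat"
  assumes "unipotent_product m k A"
  shows "unipotent_product (Suc m) k (one_block m A)"
proof -
  from assms obtain us where us: "length us \<le> k" "\<forall>u \<in> set us. unipotent_mat m u" "A = foldr (*) us (1\<^sub>m m)"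
    unfolding unipotent_product_def by blast
  have "one_block m (foldr (*) us (1\<^sub>m m)) = foldr (*) (map (one_block m) us) (1\<^sub>m (Suc m))"
    using us(2)
  proof (induction us)
    case Nil
    then show ?case using one_block_one [of m] by (simp del: One_nat_def plus_1_eq_Suc)
  next
    case (Cons u us)
    then have "u \<in> carrier_mat m m" "foldr (*) us (1\<^sub>m m) \<in> carrier_mat m m"
      by (auto intro!: foldr_mat_carrier dest: unipotent_carrier)
    with Cons show ?case by (simp add: one_block_mult del: One_nat_def)
  qed
  then show ?thesis unfolding unipotent_product_def us(3)
    using us unipotent_lower_block [OF zero_carrier_mat] by (intro exI [of _ "map (one_block m) us"]) auto
qed

section \<open>Commutators as products of three unipotents\<close>

definition mat2 :: "'a \<Rightarrow> 'a \<Rightarrow> 'a \<Rightarrow> 'a \<Rightarrow> 'a::division_ring mat" where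
  "mat2 a b c d = mat 2 2 (\<lambda>(i,j). if i = 0 then if j = 0 then a else b else if j = 0 then c else d)"

lemma mat2_carrier [simp]: "mat2 a b c d \<in> carrier_mat 2 2"
  by (simp add: mat2_def)

lemma mat2_mult [simp]:
  "mat2 a b c d * mat2 e f g h = mat2 (a * e + b * g) (a * f + b * h) (c * e + d * g) (c * f + d * h)"
  by (rule eq_matI) (auto simp: mat2_def scalar_prod_def numeral_2_eq_2 less_Suc_eq)

lemma one_mat2: "1\<^sub>m 2 = mat2 1 0 0 1"
  by (rule eq_matI) (auto simp: mat2_def less_2_cases_iff)

text \<open>
  The hypotheses say that \<open>1 - M\<close> has square zero.
\<close>

lemma unipotent_mat2:
  assumes "(1 - a) * (1 - a) + b * c = 0" "(1 - a) * b + b * (1 - d) = 0"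
    "c * (1 - a) + (1 - d) * c = 0" "c * b + (1 - d) * (1 - d) = 0"
  shows "unipotent_mat 2 (mat2 a b c d)"
proof -
  have "1\<^sub>m 2 - mat2 a b c d = mat2 (1 - a) (- b) (- c) (1 - d)"
    by (rule eq_matI) (auto simp: mat2_def less_2_cases_iff)
  moreover have "mat2 (1 - a) (- b) (- c) (1 - d) * mat2 (1 - a) (- b) (- c) (1 - d) = mat2 0 0 0 0"
    using assms by (simp add: add_eq_0_iff algebra_simps)
  moreover have "mat2 0 0 0 0 = 0\<^sub>m 2 2"
    by (rule eq_matI) (auto simp: mat2_def)
  ultimately have "(1\<^sub>m 2 - mat2 a b c d) ^\<^sub>m 2 = 0\<^sub>m 2 2"
    by (simp add: numeral_2_eq_2 left_mult_one_mat [of _ 2 2])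
  then show ?thesis unfolding unipotent_mat_def by auto
qed

text \<open>
  The companion matrix of \<open>z\<^sup>2 - z t + d\<close>.
\<close>

definition companion :: "'a \<Rightarrow> 'a \<Rightarrow> 'a::division_ring mat" where
  "companion d t = mat2 0 (- d) 1 t"

lemma unipotent_product_companion_one: "unipotent_product 2 2 (companion 1 t)"
proof -
  have "companion 1 t = mat2 0 (- 1) 1 2 * mat2 1 (t - 2) 0 1"
    by (simp add: companion_def)
  moreover have "unipotent_mat 2 (mat2 0 (- 1) 1 (2::'a))" "unipotent_mat 2 (mat2 1 (t - 2) 0 1)"
    by (rule unipotent_mat2; simp)+
  ultimately show ?thesis
    using unipotent_product_mult [OF unipotent_product_unipotent unipotent_product_unipotent]
    by (metis one_add_one)
qed

text \<open>
  A companion matrix \<open>M\<close> means a vector \<open>v\<close> with \<open>M\<^sup>2 v = (M v) t - v c\<close>. Passing from \<open>v\<close> to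
  \<open>M v - v x\<close> replaces \<open>c\<close> by another element of its class modulo commutators. Prescribing
  \<open>q = x (t - x) - c\<close>, which amounts to a choice of \<open>t\<close>, the new constant is
  \<open>inverse x * c * inverse q * x * q\<close>, and this is \<open>1\<close> for \<open>c = [x, y]\<close> and \<open>q = inverse y\<close>.
\<close>

lemma unipotent_product_companion_commutator:
  fixes x y :: "'a::division_ring"
  assumes x: "x \<noteq> 0" and y: "y \<noteq> 0"
  defines "c \<equiv> x * y * inverse x * inverse y"
  shows "\<exists>t. unipotent_product 2 2 (companion c t)"
proof -
  define q where "q = inverse y"
  have q: "q \<noteq> 0" using y by (simp add: q_def)
  have c: "c = x * inverse q * inverse x * q" by (simp add: c_def q_def)
  have cancel: "x * (inverse x * z) = z" "inverse x * (x * z) = z" "q * (inverse q * z) = z" "inverse q * (q * z) = z" for z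
    using x q by (simp_all flip: mult.assoc)
  define s where "s = inverse x * (c + q)"
  define t' where "t' = s + inverse q * (x * q)"
  \<comment> \<open>the columns of \<open>?R\<close> are \<open>w = M v - v x\<close> and \<open>M w\<close> in the basis \<open>v, M v\<close>\<close>
  let ?R = "mat2 (- x) (- c) 1 s" and ?R' = "mat2 (- (s * inverse q)) (1 - s * (inverse q * x)) (inverse q) (inverse q * x)"
  have xs: "x * s = c + q" by (simp add: s_def cancel)
  have xs': "x * (s * z) = (c + q) * z" for z by (simp add: xs flip: mult.assoc)
  have RR': "?R * ?R' = 1\<^sub>m 2" "?R' * ?R = 1\<^sub>m 2"
    using q by (simp_all add: one_mat2 xs xs' algebra_simps cancel)
  have "companion c (x + s) * ?R = ?R * companion 1 t'"
  proof -
    have 1: "c * (inverse q * (x * q)) = x" using q by (simp add: c mult.assoc cancel)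
    have "s * (inverse q * (x * q)) = inverse x * (c * (inverse q * (x * q))) + inverse x * (q * (inverse q * (x * q)))"
      by (simp add: s_def algebra_simps)
    also have "\<dots> = 1 + q" using x q unfolding 1 by (simp add: cancel)
    finally have 2: "s * (inverse q * (x * q)) = 1 + q" .
    have "c * t' = c * s + x" "s * t' = s * s + (1 + q)" "(x + s) * s = (c + q) + s * s"
      by (simp_all add: t'_def distrib_left distrib_right 1 2 xs)
    then show ?thesis by (simp add: companion_def add.commute)
  qed
  note CR = this
  have "companion c (x + s) * (?R * ?R') = (companion c (x + s) * ?R) * ?R'"
    by (rule assoc_mult_mat [symmetric, of _ 2 2 _ 2 _ 2]) (simp_all only: companion_def mat2_carrier)
  then have eq: "companion c (x + s) = ?R * companion 1 t' * ?R'"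
    unfolding RR' CR by (simp only: companion_def right_mult_one_mat [OF mat2_carrier])
  have "unipotent_product 2 2 (companion c (x + s))"
    unfolding eq by (rule unipotent_product_conj [OF mat2_carrier mat2_carrier RR' unipotent_product_companion_one])
  then show ?thesis ..
qed

text \<open>
  For \<open>c \<noteq> 1\<close> the vector \<open>(1, 1)\<close> is cyclic for \<open>diag (1, c)\<close>, with companion matrix
  \<open>companion c (1 + c)\<close>. Multiplying this by a transvection changes the trace to any prescribed value.
\<close>

lemma unipotent_product_diag_commutator_2:
  fixes x y :: "'a::division_ring"
  assumes x: "x \<noteq> 0" and y: "y \<noteq> 0"
  shows "unipotent_product 2 3 (diag_last 2 (x * y * inverse x * inverse y))"
proof -
  define c where "c = x * y * inverse x * inverse y"
  have D: "diag_last 2 d = mat2 1 0 0 d" for d :: 'a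
    by (rule eq_matI) (auto simp: diag_last_def monomial_mat_def mat2_def less_2_cases_iff)
  show ?thesis
  proof (cases "c = 1")
    case True
    then show ?thesis
      using unipotent_product_mono [OF unipotent_product_one] by (simp add: c_def diag_last_one)
  next
    case False
    define e where "e = inverse (c - 1)"
    have "(c - 1) * e = 1" "e * (c - 1) = 1" using False by (simp_all add: e_def)
    then have e: "c * e = 1 + e" "e * c = 1 + e"
      by (simp_all add: left_diff_distrib right_diff_distrib diff_eq_eq)
    from unipotent_product_companion_commutator [OF x y] obtain t where t: "unipotent_product 2 2 (companion c t)"
      unfolding c_def by blast
    let ?R = "mat2 1 1 1 c" and ?R' = "mat2 (1 + e) (- e) (- e) e"
    have RR': "?R * ?R' = 1\<^sub>m 2" "?R' * ?R = 1\<^sub>m 2"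
      by (simp_all add: one_mat2 algebra_simps e)
    have "unipotent_mat 2 (mat2 1 (1 + c - t) 0 1)" by (rule unipotent_mat2) simp_all
    then have "unipotent_product 2 3 (companion c t * mat2 1 (1 + c - t) 0 1)"
      using unipotent_product_mult [OF t unipotent_product_unipotent] by simp
    moreover have "companion c t * mat2 1 (1 + c - t) 0 1 = companion c (1 + c)"
      by (simp add: companion_def)
    ultimately have "unipotent_product 2 3 (?R * companion c (1 + c) * ?R')"
      using unipotent_product_conj [OF _ _ RR'] by auto
    moreover have "?R * companion c (1 + c) * ?R' = mat2 1 0 0 c"
      by (simp add: companion_def algebra_simps e)
    ultimately show ?thesis by (simp add: D c_def)
  qed
qed

lemma unipotent_product_diag_commutator:
  fixes c :: "'a::division_ring"
  assumes n: "2 \<le> n" and c: "c \<in> commutator_elems"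
  shows "unipotent_product n 3 (diag_last n c)"
  using n
proof (induction n rule: dec_induct)
  case base
  then show ?case using c unipotent_product_diag_commutator_2 by (auto simp: commutator_elems_def)
next
  case (step m)
  then show ?case using unipotent_product_one_block [OF step.IH] by (simp add: one_block_diag_last del: One_nat_def)
qed

lemma unipotent_product_diag_prod_list:
  fixes cs :: "'a::division_ring list"
  assumes n: "2 \<le> n" and "set cs \<subseteq> commutator_elems"
  shows "unipotent_product n (3 * length cs) (diag_last n (prod_list cs))"
  using assms(2)
proof (induction cs)
  case Nil
  then show ?case using unipotent_product_one by (simp add: diag_last_one)
next
  case (Cons c cs)
  then show ?case
    using unipotent_product_mult [OF unipotent_product_diag_commutator [OF n, of c] Cons.IH]
    by (simp add: diag_last_mult)
qed

section \<open>Matrices of determinant one\<close>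

lemma noncentral_factor:
  fixes A :: "'a::division_ring mat"
  assumes n: "2 \<le> n" and A: "right_invertible n A" and nc: "\<not> central_scalar n A"
  shows "\<exists>P Q X Y d. P \<in> carrier_mat n n \<and> Q \<in> carrier_mat n n \<and> P * Q = 1\<^sub>m n \<and> Q * P = 1\<^sub>m n \<and>
    unipotent_mat n X \<and> unipotent_mat n Y \<and> A = P * (X * diag_last n d * Y) * Q \<and> gl_word n A d"
proof -
  have n0: "0 < n" using n by simp
  from noncentral_LDU [OF n0 A] nc obtain X Y d where XY: "unipotent_mat n X" "unipotent_mat n Y"
    "gl_word n X 1" "gl_word n Y 1" "d \<noteq> 0" "gl_similar n A (X * diag_last n d * Y)" by blast
  then obtain P Q p q where PQ: "gl_word n P p" "gl_word n Q q" "P * Q = 1\<^sub>m n" "Q * P = 1\<^sub>m n"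
    "A = P * (X * diag_last n d * Y) * Q" unfolding gl_similar_def by blast
  have nz: "p \<noteq> 0" "q \<noteq> 0" using PQ(1,2) gl_word_nonzero by blast+
  have "gl_word n A (p * (1 * d * 1) * q)"
    unfolding PQ(5) by (intro gl_word_mult PQ XY gl_word_diag_last n0)
  moreover have "abel_class (p * (1 * d * 1) * q) = abel_class d"
  proof -
    have "abel_class (p * q) = abel_class 1"
      using gl_word_unique [OF gl_word_mult [OF PQ(1,2)]] gl_word.one PQ(3) by metis
    then have "abel_class (d * (p * q)) = abel_class (d * 1)"
      using nz XY(5) by (intro abel_class_cong [OF refl]) auto
    then show ?thesis using abel_class_swap [of p d q] nz XY(5) by (simp add: mult.assoc)
  qed
  ultimately have "gl_word n A d" using XY(5) by (rule gl_word.cong)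
  then show ?thesis using PQ XY gl_word_carrier by blast
qed

lemma derived_units_field: "derived_units = {1 :: 'a::field}"
proof -
  have "comm_group (mult_grp :: 'a monoid)"
    by (rule D.group_comm_groupI) (simp add: mult.commute)
  from comm_group.derived_eq_singleton [OF this, of "carrier mult_grp"] show ?thesis by simp
qed

lemma right_invertible_gl_word: "gl_word n A c \<Longrightarrow> right_invertible n A"
  unfolding right_invertible_def using gl_word_inverse gl_word_carrier by blast

text \<open>
  Over a field the class of \<open>d\<close> determines \<open>d\<close>, so the middle factor of the triangular factorization
  disappears.
\<close>

lemma field_unipotent_product:
  fixes A :: "'a::field mat"
  assumes n: "2 \<le> n" and A: "gl_word n A 1" and nc: "\<not> central_scalar n A"
  shows "unipotent_product n 2 A"
proof -
  from noncentral_factor [OF n right_invertible_gl_word [OF A] nc] obtain P Q X Y d where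
    F: "P \<in> carrier_mat n n" "Q \<in> carrier_mat n n" "P * Q = 1\<^sub>m n" "Q * P = 1\<^sub>m n"
    "unipotent_mat n X" "unipotent_mat n Y" "A = P * (X * diag_last n d * Y) * Q" "gl_word n A d" by blast
  have "d \<in> derived_units"
    using abel_class_eq_one_iff [OF gl_word_nonzero [OF F(8)]] gl_word_unique [OF F(8) A] by blast
  then have "d = 1" unfolding derived_units_field by simp
  then have "A = P * (X * Y) * Q"
    using F(7) unipotent_carrier [OF F(5)] by (simp add: diag_last_one)
  then show ?thesis
    using unipotent_product_conj [OF F(1-4) unipotent_product_mult [OF unipotent_product_unipotent [OF F(5)] unipotent_product_unipotent [OF F(6)]]]
    by (simp add: numeral_2_eq_2)
qed

lemma unipotent_product_map_center:
  fixes A :: "'a::division_ring center mat"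
  assumes "unipotent_product n k A"
  shows "unipotent_product n k (map_mat Rep_center A)"
proof -
  from assms obtain us where us: "length us \<le> k" "\<forall>u \<in> set us. unipotent_mat n u" "A = foldr (*) us (1\<^sub>m n)"
    unfolding unipotent_product_def by blast
  have "map_mat Rep_center (foldr (*) us (1\<^sub>m n)) = foldr (*) (map (map_mat Rep_center) us) (1\<^sub>m n)"
    using us(2)
  proof (induction us)
    case Nil
    then show ?case by (simp add: center.mat_hom_one)
  next
    case (Cons u us)
    then have "u \<in> carrier_mat n n" "foldr (*) us (1\<^sub>m n) \<in> carrier_mat n n"
      by (auto intro!: foldr_mat_carrier dest: unipotent_carrier)
    with Cons show ?case by (simp add: center.mat_hom_mult)
  qed
  moreover have "unipotent_mat n (map_mat Rep_center u)" if u: "unipotent_mat n u" for u :: "'a center mat"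
  proof -
    from u obtain m where m: "u \<in> carrier_mat n n" "(1\<^sub>m n - u) ^\<^sub>m m = 0\<^sub>m n n" unfolding unipotent_mat_def by blast
    have "map_mat Rep_center (1\<^sub>m n - u) = 1\<^sub>m n - map_mat Rep_center u"
      using m(1) by (intro eq_matI) (auto simp: minus_center.rep_eq center.hom_one center.hom_zero)
    moreover have "map_mat Rep_center ((1\<^sub>m n - u) ^\<^sub>m m) = map_mat Rep_center (1\<^sub>m n - u) ^\<^sub>m m"
      by (rule center.mat_hom_pow [OF minus_carrier_mat [OF m(1)]])
    moreover have "map_mat Rep_center (0\<^sub>m n n) = (0\<^sub>m n n :: 'a mat)"
      by (intro eq_matI) (auto simp: center.hom_zero)
    ultimately show ?thesis unfolding unipotent_mat_def using m by auto
  qed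
  ultimately show ?thesis unfolding unipotent_product_def us(3)
    using us by (intro exI [of _ "map (map_mat Rep_center) us"]) auto
qed

lemma unipotent_addrow_first:
  fixes x :: "'a::division_ring"
  assumes "2 \<le> n"
  shows "unipotent_mat n (addrow_mat n x 0 1)"
proof -
  from assms obtain m where m: "n = Suc m" by (cases n) auto
  have "addrow_mat n x 0 1 =
    four_block_mat (1\<^sub>m 1) (mat 1 m (\<lambda>(_,j). if j = 0 then x else 0)) (0\<^sub>m m 1) (1\<^sub>m m)"
    by (rule eq_matI) (auto simp: m)
  then show ?thesis unfolding m by (simp add: unipotent_upper_block unipotent_one del: One_nat_def)
qed

lemma prod_list_const_nat: "prod_list (map (\<lambda>_. a) [0..<n]) = (a :: 'a::monoid_mult) ^ n"
  by (induction n) (simp_all add: power_commutes)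

lemma SL_D:
  fixes A :: "'a::division_ring mat"
  assumes "A \<in> SL n"
  shows "right_invertible n A" and "gl_word n A c \<Longrightarrow> c \<in> derived_units"
proof -
  have *: "A \<in> Units (ring_mat TYPE('a) n ())" "dieudonne_det n A = derived_units"
    using assms by (simp_all add: SL_def kernel_def units_of_def FactGroup_def)
  then show "right_invertible n A" unfolding right_invertible_def by (auto simp: Units_def ring_mat_simps)
  assume A: "gl_word n A c"
  then have "abel_class c = abel_class 1" using *(2) dieudonne_det_bruhat [OF gl_word_bruhat [OF A]] by (simp add: abel_class_one)
  then show "c \<in> derived_units" using abel_class_eq_one_iff [OF gl_word_nonzero [OF A]] by simp
qed

lemma noncentral_SL_unipotent_product:
  fixes A :: "'a::division_ring mat"
  assumes n: "2 \<le> n"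
    and width: "\<forall>d \<in> (derived_units :: 'a set).
      \<exists>cs. length cs \<le> k \<and> set cs \<subseteq> commutator_elems \<and> d = prod_list cs"
    and A: "A \<in> SL n" and nc: "\<not> central_scalar n A"
  shows "unipotent_product n (3 * k + 2) A"
proof -
  from noncentral_factor [OF n SL_D(1) [OF A] nc] obtain P Q X Y d where
    F: "P \<in> carrier_mat n n" "Q \<in> carrier_mat n n" "P * Q = 1\<^sub>m n" "Q * P = 1\<^sub>m n"
    "unipotent_mat n X" "unipotent_mat n Y" "A = P * (X * diag_last n d * Y) * Q" "gl_word n A d" by blast
  from width SL_D(2) [OF A F(8)] obtain cs where cs: "length cs \<le> k" "set cs \<subseteq> commutator_elems" "d = prod_list cs"
    by blast
  have "unipotent_product n (1 + 3 * length cs + 1) (X * diag_last n d * Y)"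
    unfolding cs(3) by (intro unipotent_product_mult unipotent_product_unipotent F unipotent_product_diag_prod_list n cs)
  from unipotent_product_mono [OF unipotent_product_conj [OF F(1-4) this]] show ?thesis unfolding F(7) using cs(1) by simp
qed

text \<open>
  Splitting off a transvection and applying the noncentral case would cost one factor too many. The
  detour through the centre is cheaper: a nonscalar matrix of determinant
  \<open>1\<close> over the centre takes only two factors.
\<close>

lemma central_SL_unipotent_product:
  fixes A :: "'a::division_ring mat"
  assumes n: "2 \<le> n" and k: "0 < k"
    and width: "\<forall>d \<in> (derived_units :: 'a set).
      \<exists>cs. length cs \<le> k \<and> set cs \<subseteq> commutator_elems \<and> d = prod_list cs"
    and A: "A \<in> SL n" and cent: "central_scalar n A"
  shows "unipotent_product n (3 * k + 2) A"
proof -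
  from cent obtain a where a: "\<And>x. a * x = x * a" and Aa: "A = monomial_mat n id (\<lambda>_. a)"
    unfolding central_scalar_def by blast
  have n0: "0 < n" "1 < n" using n by auto
  from SL_D(1) [OF A] obtain T where T: "T \<in> carrier_mat n n" "A * T = 1\<^sub>m n" unfolding right_invertible_def by blast
  have "(A * T) $$ (0,0) = a * T $$ (0,0)"
    unfolding Aa using T(1) n0 by (simp add: monomial_mat_mult)
  moreover have "(A * T) $$ (0,0) = 1" unfolding T(2) using n0 by simp
  ultimately have a0: "a \<noteq> 0" by auto
  have "gl_word n A (a ^ n)"
    unfolding Aa using gl_word_diag [of n "\<lambda>_. a"] a0 by (simp add: prod_list_const_nat)
  from SL_D(2) [OF A this] have an: "a ^ n \<in> derived_units" .
  define z where "z = Abs_center a"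
  have Rz: "Rep_center z = a" unfolding z_def by (rule Abs_center_inverse) (use a in simp)
  have z0: "z \<noteq> 0" using Rz a0 center.hom_zero by metis
  have ncz: "\<not> central_scalar n B" if "B $$ (i,j) \<noteq> 0" "i \<noteq> j" "i < n" "j < n" for B :: "'a center mat" and i j
    using central_scalar_off_diagonal [of n B] that by auto
  show ?thesis
  proof (cases "z ^ n = 1")
    case True
    \<comment> \<open>\<open>A\<close> itself is a matrix over the centre of determinant \<open>1\<close>; the transvection makes it nonscalar\<close>
    let ?B = "monomial_mat n id (\<lambda>_. z) * addrow_mat n 1 0 1"
    have B: "?B = mat n n (\<lambda>(i,j). if j = 1 then monomial_mat n id (\<lambda>_. z) $$ (i,1) + monomial_mat n id (\<lambda>_. z) $$ (i,0) * 1
      else monomial_mat n id (\<lambda>_. z) $$ (i,j))"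
      by (rule mult_addrow_mat) (use n0 in auto)
    have "?B $$ (0,1) = z" unfolding B using n0 by (simp add: monomial_mat_def)
    then have "\<not> central_scalar n ?B" using ncz [of ?B 0 1] z0 n0 by simp
    moreover have "gl_word n ?B 1"
      using gl_word_mult [OF gl_word_diag [of n "\<lambda>_. z"] gl_word_unitri [OF upper_unitriangular_addrow_mat [of 0 1 n 1]]]
        z0 n0 True by (simp add: prod_list_const_nat)
    ultimately have "unipotent_product n 2 ?B" using field_unipotent_product [OF n] by blast
    from unipotent_product_map_center [OF this] have "unipotent_product n 2 (map_mat Rep_center ?B)" .
    also have "map_mat Rep_center ?B = A * addrow_mat n 1 0 1"
    proof -
      have "map_mat Rep_center (monomial_mat n id (\<lambda>_. z)) = A"
        unfolding Aa by (rule eq_matI) (auto simp: monomial_mat_def Rz center.hom_zero)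
      moreover have "map_mat Rep_center (addrow_mat n 1 0 1) = (addrow_mat n 1 0 1 :: 'a mat)"
        by (rule eq_matI) (auto simp: center.hom_zero center.hom_one center.hom_add)
      ultimately show ?thesis using center.mat_hom_mult [of "monomial_mat n id (\<lambda>_. z)" n n "addrow_mat n 1 0 1" n] by simp
    qed
    finally have "unipotent_product n (2 + 1) (A * addrow_mat n 1 0 1 * addrow_mat n (- 1) 0 1)"
      using unipotent_product_unipotent [OF unipotent_addrow_first [OF n]] by (rule unipotent_product_mult)
    moreover have "A * addrow_mat n 1 0 1 * addrow_mat n (- 1) 0 1 = A"
      unfolding Aa using addrow_mat_inverse(1) [of 0 n 1 "1 :: 'a"] n0
      by (simp add: assoc_mult_mat [of _ n n _ n _ n] right_mult_one_mat [of _ n n])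
    ultimately have "unipotent_product n (2 + 1) A" by simp
    then show ?thesis by (rule unipotent_product_mono) (use k in simp)
  next
    case False
    \<comment> \<open>the last entry is chosen to make the determinant \<open>1\<close>; as \<open>a ^ n \<noteq> 1\<close>, it differs from the others\<close>
    define d where "d = (\<lambda>i. if Suc i = n then z * inverse (z ^ n) else z)"
    let ?B = "monomial_mat n id d"
    have dz: "d = (\<lambda>i. z * (if Suc i = n then inverse (z ^ n) else 1))" by (auto simp: d_def)
    have "monomial_mat n id (\<lambda>_. z) * diag_last n (inverse (z ^ n)) = ?B"
      unfolding diag_last_def by (subst monomial_mat_diag_mult) (simp_all add: dz)
    moreover have "gl_word n (monomial_mat n id (\<lambda>_. z) * diag_last n (inverse (z ^ n))) (z ^ n * inverse (z ^ n))"
      using gl_word_mult [OF gl_word_diag [of n "\<lambda>_. z"] gl_word_diag_last [OF n0(1), of "inverse (z ^ n)"]] z0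
      by (simp add: prod_list_const_nat)
    ultimately have gB: "gl_word n ?B 1" using z0 by simp
    have "\<not> central_scalar n ?B"
    proof
      assume "central_scalar n ?B"
      from central_scalar_off_diagonal [OF this] obtain w where
        "\<And>i. i < n \<Longrightarrow> ?B $$ (i,i) = w" by auto
      from this [of 0] this [of "n - 1"] have "d 0 = d (n - 1)" using n0 by (simp add: monomial_mat_def)
      then have "z = z * inverse (z ^ n)" using n0 by (simp add: d_def)
      then show False using z0 False by simp
    qed
    then have "unipotent_product n 2 ?B" by (rule field_unipotent_product [OF n gB])
    from unipotent_product_map_center [OF this] have B: "unipotent_product n 2 (map_mat Rep_center ?B)" .
    from width an obtain cs where cs: "length cs \<le> k" "set cs \<subseteq> commutator_elems" "a ^ n = prod_list cs" by blast
    have "map_mat Rep_center ?B = monomial_mat n id (\<lambda>i. if Suc i = n then a * inverse (a ^ n) else a)"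
      by (rule eq_matI) (auto simp: monomial_mat_def d_def Rz center.hom_zero center.hom_mult Rep_center_inverse Rep_center_power)
    then have "map_mat Rep_center ?B * diag_last n (a ^ n) = monomial_mat n id
        (\<lambda>i. (if Suc i = n then a * inverse (a ^ n) else a) * (if Suc i = n then a ^ n else 1))"
      by (simp add: diag_last_def monomial_mat_diag_mult)
    also have "(\<lambda>i. (if Suc i = n then a * inverse (a ^ n) else a) * (if Suc i = n then a ^ n else 1)) = (\<lambda>_. a)"
      using a0 by (auto simp: mult.assoc)
    finally have "map_mat Rep_center ?B * diag_last n (a ^ n) = A" unfolding Aa .
    with unipotent_product_mult [OF B unipotent_product_diag_prod_list [OF n cs(2)]] have "unipotent_product n (2 + 3 * length cs) A"
      unfolding cs(3) by simp
    then show ?thesis by (rule unipotent_product_mono) (use cs(1) in simp)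
  qed
qed

theorem theorem4p1:
  fixes A :: "'a::division_ring mat" and n k :: nat
  assumes noncomm: "\<exists>x y :: 'a. x * y \<noteq> y * x"
    and n: "n \<ge> 2"
    and k: "k > 0"
    and width: "\<forall>d \<in> (derived_units :: 'a set).
      \<exists>cs. length cs \<le> k \<and> set cs \<subseteq> commutator_elems \<and> d = prod_list cs"
    and A: "A \<in> SL n"
  shows "\<exists>us. length us \<le> 3 * k + 2 \<and> (\<forall>u \<in> set us. unipotent_mat n u) \<and>
    A = foldr (*) us (1\<^sub>m n)"
  using central_SL_unipotent_product [OF n k width A] noncentral_SL_unipotent_product [OF n width A]
  unfolding unipotent_product_def by blast

end
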